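(* Let $(L,G)$ and $(K,H)$ be generator-enriched lattices such that there is a strong surjection from $(L,G)$ onto $(K,H)$. Then the minor poset $\mathrm{M}(K,H)$ can be obtained from $\mathrm{M}(L,G)$ via a sequence of zipping operations; that is, there is a finite (possibly empty) sequence of posets $P_0=\mathrm{M}(L,G),P_1,\dots,P_r$ with $P_r\cong \mathrm{M}(K,H)$ such that for each $1\le i\le r$ there is a zipper $x_i,y_i,z_i$ in $P_{i-1}$ with $P_i=\mathrm{zip}(P_{i-1},z_i)$.
   Context: A generator-enriched lattice is a pair $(L,G)$ where $L$ is a finite lattice and $G\subseteq L\setminus\{\widehat 0\}$ generates $L$ under joins (the empty join is $\widehat 0$). Elements of $G$ are called generators. For a set $H\subseteq L$ and $z\in L$ with $z<h$ for all $h\in H$, $\langle H|z\rangle=(\{z\vee\bigvee_{x\in X}x: X\subseteq H\},H)$, a generator-enriched lattice with minimum $z$ (joins computed in $L$). For $I\subseteq G$, the deletion is $(L,G)\setminus I=\langle G\setminus I\,|\,\widehat 0\rangle$ and the contraction is $(L,G)/I=\langle\{g\vee i_0: g\in G\}\setminus\{i_0\}\,|\,i_0\rangle$ where $i_0=\bigvee_{i\in I}i$. A minor of $(L,G)$ is any generator-enriched lattice obtained from $(L,G)$ by a (possibly empty) sequence of deletions and contractions. The minor poset $\mathrm{M}(L,G)$ consists of all minors of $(L,G)$ together with an adjoined minimum element $\emptyset$, ordered by $(K_1,H_1)\le(K_2,H_2)$ when $(K_1,H_1)$ is a minor of $(K_2,H_2)$. A strong map $f:(L,G)\to(K,H)$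 is a join-preserving map $f:L\to K$ (including the empty join, so $f(\widehat 0_L)=\widehat 0_K$) with $f(G)\subseteq H\cup\{\widehat 0_K\}$; it is surjective (a strong surjection) when $f(G\cup\{\widehat 0_L\})=H\cup\{\widehat 0_K\}$. Zipping: elements $x,y,z$ of a poset $P$ (with $x\neq y$) form a zipper if (i) $z$ covers exactly the two elements $x$ and $y$; (ii) $z=x\vee y$ (the join exists in $P$ and equals $z$); (iii) $\{p\in P:p<x\}=\{p\in P:p<y\}$. Given a zipper $x,y,z$, the poset $\mathrm{zip}(P,z)$ has underlying set $(P\setminus\{x,y,z\})\cup\{w\}$ with $w$ a new element, and for $p,q\in P\setminus\{x,y,z\}$: $p\le w$ iff $p\le z$ in $P$; $w\le p$ iff $x\le p$ or $y\le p$ in $P$; $p\le q$ iff $p\le q$ in $P$. *)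

theory Defs
  imports "HOL-Algebra.Complete_Lattice"
begin

section \<open>Generator-enriched lattices and their minors\<close>

text \<open>
  Nonemptiness of the carrier is required explicitly: the locale \<^locale>\<open>lattice\<close> admits the
  empty carrier, which has no minimum. The join of the empty set in \<open>L\<close> is \<open>\<bottom>\<^bsub>L\<^esub>\<close>.
\<close>

locale gen_enriched_lattice = lattice L for L :: "'a gorder" (structure) +
  fixes G :: "'a set"
  assumes finite_carrier: "finite (carrier L)"
    and carrier_nonempty: "carrier L \<noteq> {}"
    and generators: "G \<subseteq> carrier L - {\<bottom>}"
    and generates: "\<forall>x\<in>carrier L. \<exists>X\<subseteq>G. x = \<Squnion>X"

text \<open>
  \<open>span_from L H z\<close> is $\langle H|z\rangle$. Its order is that of \<open>L\<close> restricted to a new carrier;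
  the joins forming the carrier are those of \<open>L\<close>. It is only meaningful when \<open>z\<close> lies strictly
  below all elements of \<open>H\<close>.
\<close>

definition span_from :: "'a gorder \<Rightarrow> 'a set \<Rightarrow> 'a \<Rightarrow> 'a gorder \<times> 'a set" where
  "span_from L H z = (L\<lparr>carrier := {z \<squnion>\<^bsub>L\<^esub> \<Squnion>\<^bsub>L\<^esub>X | X. X \<subseteq> H}\<rparr>, H)"

definition deletion :: "'a gorder \<Rightarrow> 'a set \<Rightarrow> 'a set \<Rightarrow> 'a gorder \<times> 'a set" where
  "deletion L G I = span_from L (G - I) \<bottom>\<^bsub>L\<^esub>"

definition contraction :: "'a gorder \<Rightarrow> 'a set \<Rightarrow> 'a set \<Rightarrow> 'a gorder \<times> 'a set" where
  "contraction L G I =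
     (let i0 = \<Squnion>\<^bsub>L\<^esub>I in span_from L ((\<lambda>g. g \<squnion>\<^bsub>L\<^esub> i0) ` G - {i0}) i0)"

inductive minor_of :: "'a gorder \<times> 'a set \<Rightarrow> 'a gorder \<times> 'a set \<Rightarrow> bool" where
  refl: "minor_of LG LG"
| deletion: "minor_of (K, H) LG \<Longrightarrow> I \<subseteq> H \<Longrightarrow> minor_of (deletion K H I) LG"
| contraction: "minor_of (K, H) LG \<Longrightarrow> I \<subseteq> H \<Longrightarrow> minor_of (contraction K H I) LG"

text \<open>
  In the minor poset \<^const>\<open>None\<close> is the adjoined minimum $\emptyset$. All minors of \<open>(L, G)\<close> share
  the \<^const>\<open>le\<close> and \<^const>\<open>eq\<close> fields of \<open>L\<close>, so equality of records is equality of carriers.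
\<close>

definition minor_poset :: "'a gorder \<Rightarrow> 'a set \<Rightarrow> ('a gorder \<times> 'a set) option gorder" where
  "minor_poset L G =
     \<lparr>carrier = insert None (Some ` {KH. minor_of KH (L, G)}),
      eq = (=),
      le = (\<lambda>p q. case p of None \<Rightarrow> True
                 | Some KH1 \<Rightarrow> (case q of None \<Rightarrow> False | Some KH2 \<Rightarrow> minor_of KH1 KH2))\<rparr>"


section \<open>Strong maps\<close>

definition strong_map ::
  "'a gorder \<Rightarrow> 'a set \<Rightarrow> 'b gorder \<Rightarrow> 'b set \<Rightarrow> ('a \<Rightarrow> 'b) \<Rightarrow> bool" where
  "strong_map L G K H f \<longleftrightarrow>
     f \<in> carrier L \<rightarrow> carrier K \<and> join_pres L K f \<and> f \<bottom>\<^bsub>L\<^esub> = \<bottom>\<^bsub>K\<^esub> \<and>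
     f ` G \<subseteq> H \<union> {\<bottom>\<^bsub>K\<^esub>}"

definition strong_surjection ::
  "'a gorder \<Rightarrow> 'a set \<Rightarrow> 'b gorder \<Rightarrow> 'b set \<Rightarrow> ('a \<Rightarrow> 'b) \<Rightarrow> bool" where
  "strong_surjection L G K H f \<longleftrightarrow>
     strong_map L G K H f \<and> f ` (G \<union> {\<bottom>\<^bsub>L\<^esub>}) = H \<union> {\<bottom>\<^bsub>K\<^esub>}"


section \<open>Zipping\<close>

definition covers :: "'e gorder \<Rightarrow> 'e \<Rightarrow> 'e \<Rightarrow> bool" where
  "covers P z x \<longleftrightarrow> z \<in> carrier P \<and> x \<in> carrier P \<and> x \<sqsubset>\<^bsub>P\<^esub> z \<and>
     \<not> (\<exists>p\<in>carrier P. x \<sqsubset>\<^bsub>P\<^esub> p \<and> p \<sqsubset>\<^bsub>P\<^esub> z)"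

definition zipper :: "'e gorder \<Rightarrow> 'e \<Rightarrow> 'e \<Rightarrow> 'e \<Rightarrow> bool" where
  "zipper P x y z \<longleftrightarrow>
     x \<in> carrier P \<and> y \<in> carrier P \<and> z \<in> carrier P \<and> x \<noteq> y \<and>
     {p. covers P z p} = {x, y} \<and>
     least P z (Upper P {x, y}) \<and>
     {p \<in> carrier P. p \<sqsubset>\<^bsub>P\<^esub> x} = {p \<in> carrier P. p \<sqsubset>\<^bsub>P\<^esub> y}"

text \<open>
  The new element \<open>w\<close> is a parameter; it is meant to satisfy \<open>w \<notin> carrier P\<close>. For a zipper, \<open>z\<close>
  determines \<open>{x, y}\<close>, in which the construction is symmetric.
\<close>

definition zip_poset :: "'e gorder \<Rightarrow> 'e \<Rightarrow> 'e \<Rightarrow> 'e \<Rightarrow> 'e \<Rightarrow> 'e gorder" where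
  "zip_poset P x y z w =
     \<lparr>carrier = insert w (carrier P - {x, y, z}),
      eq = (=),
      le = (\<lambda>p q. if p = w then q = w \<or> x \<sqsubseteq>\<^bsub>P\<^esub> q \<or> y \<sqsubseteq>\<^bsub>P\<^esub> q
                  else if q = w then p \<sqsubseteq>\<^bsub>P\<^esub> z
                  else p \<sqsubseteq>\<^bsub>P\<^esub> q)\<rparr>"

text \<open>
  All posets of a zipping sequence have the same element type, so new elements are drawn from that
  type. For \<open>P = minor_poset L G\<close> there is always room: \<open>Some (L, {\<bottom>\<^bsub>L\<^esub>})\<close> is not in the carrier,
  and elements removed by one step may be reused as the new element of a later one.
\<close>

definition zip_step :: "'e gorder \<Rightarrow> 'e gorder \<Rightarrow> bool" where
  "zip_step P Q \<longleftrightarrow>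
     (\<exists>x y z w. zipper P x y z \<and> w \<notin> carrier P \<and> Q = zip_poset P x y z w)"

definition poset_isomorphic :: "'e gorder \<Rightarrow> 'f gorder \<Rightarrow> bool" where
  "poset_isomorphic P Q \<longleftrightarrow> (\<exists>h. bij_betw h (carrier P) (carrier Q) \<and> order_emb P Q h)"

end

theory Submission
  imports Defs
begin

text \<open>
  A minor of \<open>(L, G)\<close> is determined by its minimum \<open>z\<close> and its generating set \<open>A\<close>, and a strong
  surjection \<open>f\<close> induces a map of minor posets sending \<open>(z, A)\<close> to \<open>(f z, f ` A - {f z})\<close>. This map
  is surjective, monotone and lifts relations downwards. If \<open>f\<close> is not injective, choose \<open>a\<close> maximal
  with \<open>f a = f b\<close> for some \<open>b > a\<close>; then \<open>b\<close> is the only cover of \<open>a\<close>, and \<open>f\<close> factors through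
  the lattice obtained by removing \<open>a\<close>, which identifies \<open>a\<close> with \<open>b\<close>. For this elementary
  surjection all fibres on minors have one element or are of the form \<open>{x, y, x \<squnion> y}\<close>. Downward
  lifting makes a fibre of the latter kind a zipper as soon as all the fibres below it are
  singletons, so zipping the fibres from the bottom up collapses the map to an isomorphism.
\<close>

section \<open>Zipping along monotone maps\<close>

text \<open>The intermediate posets are not presented as minor posets of any lattice. Pairs are used
  because iterated deletions and contractions compute joins in ever smaller lattices, whereas
  \<open>ple\<close> is a closed formula in \<open>L\<close>: one contraction, then one deletion.
  The size three of the fibres has two sources. If the minimum becomes \<open>b\<close>, it was
  \<open>a\<close> or \<open>b\<close>, and \<open>b\<close> may also have been a generator, except
  when it is the minimum itself: four combinations less one. Otherwise a generator \<open>b\<close>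
  of the image comes from a nonempty subset of \<open>{a, b}\<close>: again four less one. The two
  sources never mix, since generators lie strictly above the minimum, so \<open>a\<close> is no
  generator when the minimum is \<open>a\<close> or \<open>b\<close>.\<close>

lemma poset_isomorphicE:
  assumes "poset_isomorphic P Q"
  obtains h where "bij_betw h (carrier P) (carrier Q)" "weak_partial_order P" "weak_partial_order Q"
    "\<And>x y. x \<in> carrier P \<Longrightarrow> y \<in> carrier P \<Longrightarrow> h x \<sqsubseteq>\<^bsub>Q\<^esub> h y \<longleftrightarrow> x \<sqsubseteq>\<^bsub>P\<^esub> y"
  using assms unfolding poset_isomorphic_def order_emb_def by blast

lemma poset_isomorphicI:
  assumes "bij_betw h (carrier P) (carrier Q)" "weak_partial_order P" "weak_partial_order Q"
    "\<And>x y. x \<in> carrier P \<Longrightarrow> y \<in> carrier P \<Longrightarrow> h x \<sqsubseteq>\<^bsub>Q\<^esub> h y \<longleftrightarrow> x \<sqsubseteq>\<^bsub>P\<^esub> y"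
  shows "poset_isomorphic P Q"
  using assms unfolding poset_isomorphic_def order_emb_def by blast

lemma poset_isomorphic_sym:
  assumes "poset_isomorphic P Q"
  shows "poset_isomorphic Q P"
proof -
  obtain h where h: "bij_betw h (carrier P) (carrier Q)" "weak_partial_order P" "weak_partial_order Q"
    "\<And>x y. x \<in> carrier P \<Longrightarrow> y \<in> carrier P \<Longrightarrow> h x \<sqsubseteq>\<^bsub>Q\<^esub> h y \<longleftrightarrow> x \<sqsubseteq>\<^bsub>P\<^esub> y"
    using assms by (rule poset_isomorphicE) blast
  let ?g = "inv_into (carrier P) h"
  have g: "bij_betw ?g (carrier Q) (carrier P)"
    using h(1) by (rule bij_betw_inv_into)
  show ?thesis
  proof (rule poset_isomorphicI[OF g h(3,2)])
    fix x y assume xy: "x \<in> carrier Q" "y \<in> carrier Q"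
    then have "?g x \<in> carrier P" "?g y \<in> carrier P" "h (?g x) = x" "h (?g y) = y"
      using g h(1) by (auto simp: bij_betw_apply bij_betw_inv_into_right)
    then show "?g x \<sqsubseteq>\<^bsub>P\<^esub> ?g y \<longleftrightarrow> x \<sqsubseteq>\<^bsub>Q\<^esub> y"
      using h(4) by metis
  qed
qed

lemma poset_isomorphic_trans:
  assumes "poset_isomorphic P Q" "poset_isomorphic Q R"
  shows "poset_isomorphic P R"
proof -
  obtain h where h: "bij_betw h (carrier P) (carrier Q)" "weak_partial_order P"
    "\<And>x y. x \<in> carrier P \<Longrightarrow> y \<in> carrier P \<Longrightarrow> h x \<sqsubseteq>\<^bsub>Q\<^esub> h y \<longleftrightarrow> x \<sqsubseteq>\<^bsub>P\<^esub> y"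
    using assms(1) by (rule poset_isomorphicE) blast
  obtain k where k: "bij_betw k (carrier Q) (carrier R)" "weak_partial_order R"
    "\<And>x y. x \<in> carrier Q \<Longrightarrow> y \<in> carrier Q \<Longrightarrow> k x \<sqsubseteq>\<^bsub>R\<^esub> k y \<longleftrightarrow> x \<sqsubseteq>\<^bsub>Q\<^esub> y"
    using assms(2) by (rule poset_isomorphicE) blast
  show ?thesis
    by (rule poset_isomorphicI[OF bij_betw_trans[OF h(1) k(1)] h(2) k(2)])
      (simp add: h k bij_betw_apply[OF h(1)])
qed

lemma (in partial_order) lless_iff: "x \<sqsubset> y \<longleftrightarrow> x \<sqsubseteq> y \<and> x \<noteq> y"
  by (simp add: lless_def eq_is_equal)

text \<open>Strictly smaller elements have strictly smaller principal down-sets, so a member of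
  \<open>T\<close> whose down-set has least cardinality is minimal.\<close>

lemma (in partial_order) finite_has_minimal:
  assumes "finite (carrier L)" "T \<subseteq> carrier L" "T \<noteq> {}"
  obtains t where "t \<in> T" "\<And>s. s \<in> T \<Longrightarrow> s \<sqsubseteq> t \<Longrightarrow> s = t"
proof -
  let ?m = "\<lambda>t. card {q \<in> carrier L. q \<sqsubseteq> t}"
  obtain t where t: "t \<in> T" "\<And>s. s \<in> T \<Longrightarrow> ?m t \<le> ?m s"
    using ex_has_least_nat[of "\<lambda>t. t \<in> T" _ ?m] assms(3) by blast
  show ?thesis
  proof (rule that[OF t(1)])
    fix s assume s: "s \<in> T" "s \<sqsubseteq> t"
    have c: "s \<in> carrier L" "t \<in> carrier L" using s t assms by auto
    show "s = t"
    proof (rule ccontr)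
      assume "s \<noteq> t"
      then have "\<not> t \<sqsubseteq> s" using c s(2) le_antisym by blast
      then have "{q \<in> carrier L. q \<sqsubseteq> s} \<subset> {q \<in> carrier L. q \<sqsubseteq> t}"
        using c s(2) le_trans by blast
      then have "?m s < ?m t" by (rule psubset_card_mono[rotated]) (simp add: assms(1))
      then show False using t(2)[OF s(1)] by simp
    qed
  qed
qed

lemma (in partial_order) finite_has_maximal:
  assumes "finite (carrier L)" "T \<subseteq> carrier L" "T \<noteq> {}"
  obtains t where "t \<in> T" "\<And>s. s \<in> T \<Longrightarrow> t \<sqsubseteq> s \<Longrightarrow> s = t"
proof -
  interpret dual: partial_order "inv_gorder L"
    by (simp add: dual_order)
  show ?thesis
    using dual.finite_has_minimal[of T] assms that by auto
qed

text \<open>The assumption \<open>below\<close> is what makes the order of \<^const>\<open>zip_poset\<close> transitive through \<open>w\<close>.\<close>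

locale zipper_order = partial_order P for P :: "'e gorder" (structure) +
  fixes x y z w :: 'e
  assumes carr: "x \<in> carrier P" "y \<in> carrier P" "z \<in> carrier P"
    and ord: "x \<sqsubseteq> z" "y \<sqsubseteq> z" "\<not> x \<sqsubseteq> y" "\<not> y \<sqsubseteq> x"
    and join: "\<And>u. \<lbrakk>u \<in> carrier P; x \<sqsubseteq> u; y \<sqsubseteq> u\<rbrakk> \<Longrightarrow> z \<sqsubseteq> u"
    and below: "\<And>p. \<lbrakk>p \<in> carrier P; p \<sqsubseteq> z; p \<notin> {x, y, z}\<rbrakk> \<Longrightarrow> p \<sqsubseteq> x \<and> p \<sqsubseteq> y"
    and fresh: "w \<notin> carrier P"
begin

lemma distinct: "x \<noteq> y" "x \<noteq> z" "y \<noteq> z"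
  using ord carr by auto

text \<open>By \<open>below\<close>, any further element under \<open>z\<close> lies under both
  \<open>x\<close> and \<open>y\<close>, so \<open>z\<close> does not cover it. An element strictly
  between \<open>x\<close> and \<open>z\<close> would for the same reason lie under
  \<open>y\<close>, making \<open>x\<close> and \<open>y\<close> comparable.\<close>

lemma covers_iff: "covers P z p \<longleftrightarrow> p = x \<or> p = y"
proof
  assume c: "covers P z p"
  then have p: "p \<in> carrier P" "p \<sqsubseteq> z" "p \<noteq> z"
    by (auto simp: covers_def lless_iff)
  show "p = x \<or> p = y"
  proof (rule ccontr)
    assume n: "\<not> (p = x \<or> p = y)"
    then have "p \<sqsubseteq> x" using below p by blast
    then show False using c n carr ord distinct unfolding covers_def lless_iff by auto
  qed
next
  assume p: "p = x \<or> p = y"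
  have "p' = z \<or> p' = p" if "p' \<in> carrier P" "p \<sqsubseteq> p'" "p' \<sqsubseteq> z" for p'
  proof (rule ccontr)
    assume n: "\<not> (p' = z \<or> p' = p)"
    have "p' \<noteq> x \<and> p' \<noteq> y" using p n ord that by auto
    then have b: "p' \<sqsubseteq> x" "p' \<sqsubseteq> y" using below that n by blast+
    have "x \<sqsubseteq> y \<or> y \<sqsubseteq> x" using p le_trans b that carr by metis
    then show False using ord by blast
  qed
  then show "covers P z p"
    using p carr ord distinct unfolding covers_def lless_iff by blast
qed

lemma zipper: "zipper P x y z"
proof -
  have "p \<sqsubseteq> y \<and> p \<noteq> y" if "p \<in> carrier P" "p \<sqsubseteq> x" "p \<noteq> x" for p
  proof -
    have "p \<sqsubseteq> z" using that carr ord le_trans by blast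
    moreover have "p \<noteq> z" "p \<noteq> y" using that carr ord by (auto intro: le_antisym)
    ultimately show ?thesis using below that by blast
  qed
  moreover have "p \<sqsubseteq> x \<and> p \<noteq> x" if "p \<in> carrier P" "p \<sqsubseteq> y" "p \<noteq> y" for p
  proof -
    have "p \<sqsubseteq> z" using that carr ord le_trans by blast
    moreover have "p \<noteq> z" "p \<noteq> x" using that carr ord by (auto intro: le_antisym)
    ultimately show ?thesis using below that by blast
  qed
  ultimately have "{p \<in> carrier P. p \<sqsubset> x} = {p \<in> carrier P. p \<sqsubset> y}"
    by (auto simp: lless_iff)
  moreover have "least P z (Upper P {x, y})"
  proof (rule least_UpperI)
    show "z \<sqsubseteq> u" if "u \<in> Upper P {x, y}" for u
      by (rule join) (use that carr in \<open>auto simp: Upper_def\<close>)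
  qed (use carr ord in auto)
  ultimately show ?thesis
    using carr distinct unfolding zipper_def by (auto simp: covers_iff)
qed

abbreviation "Z \<equiv> zip_poset P x y z w"

lemma carrier_Z: "carrier Z = insert w (carrier P - {x, y, z})"
  by (simp add: zip_poset_def)

lemma le_Z:
  "p \<sqsubseteq>\<^bsub>Z\<^esub> q \<longleftrightarrow> (if p = w then q = w \<or> x \<sqsubseteq> q \<or> y \<sqsubseteq> q else if q = w then p \<sqsubseteq> z else p \<sqsubseteq> q)"
  by (simp add: zip_poset_def)

lemma zip_step: "zip_step P Z"
  using zipper fresh unfolding zip_step_def by blast

lemma partial_order_Z: "partial_order Z"
proof -
  have eqZ: "eq Z = (=)" by (simp add: zip_poset_def)
  have trans: "p \<sqsubseteq>\<^bsub>Z\<^esub> r" if pqr: "p \<in> carrier Z" "q \<in> carrier Z" "r \<in> carrier Z"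
    and pq: "p \<sqsubseteq>\<^bsub>Z\<^esub> q" and qr: "q \<sqsubseteq>\<^bsub>Z\<^esub> r" for p q r
  proof (cases "q = w")
    case True
    show ?thesis
    proof (cases "p = w \<or> r = w")
      case True
      then show ?thesis using pq qr \<open>q = w\<close> by auto
    next
      case False
      then have "p \<sqsubseteq> z" "x \<sqsubseteq> r \<or> y \<sqsubseteq> r" "p \<in> carrier P" "p \<notin> {x,y,z}" "r \<in> carrier P"
        using pq qr True pqr by (auto simp: le_Z carrier_Z)
      then have "p \<sqsubseteq> r" using below carr le_trans by metis
      then show ?thesis using False by (simp add: le_Z)
    qed
  next
    case False
    then have q: "q \<in> carrier P" using pqr by (simp add: carrier_Z)
    show ?thesis using pq qr pqr False q carr le_trans
      by (auto simp: le_Z carrier_Z split: if_splits)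
  qed
  have antisym: "p = q" if "p \<in> carrier Z" "q \<in> carrier Z" "p \<sqsubseteq>\<^bsub>Z\<^esub> q" "q \<sqsubseteq>\<^bsub>Z\<^esub> p" for p q
  proof -
    \<comment> \<open>No old element is both above and below \<open>w\<close>: \<open>below\<close>
      would force it to equal \<open>x\<close> or \<open>y\<close>.\<close>
    have *: False if r: "r \<in> carrier P" "r \<notin> {x, y, z}" "r \<sqsubseteq> z" "x \<sqsubseteq> r \<or> y \<sqsubseteq> r" for r
      using below[OF r(1,3,2)] r carr le_antisym by blast
    show ?thesis
      using that * by (auto simp: le_Z carrier_Z split: if_splits intro: le_antisym)
  qed
  show ?thesis
  proof unfold_locales
    show "p \<sqsubseteq>\<^bsub>Z\<^esub> p" if "p \<in> carrier Z" for p
      using that by (auto simp: le_Z carrier_Z)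
  qed (use antisym in \<open>simp_all add: eqZ\<close>, rule trans)
qed

end

text \<open>A lower lifting is an open map for the topologies of down-sets.\<close>

definition lower_lifting :: "'e gorder \<Rightarrow> 'f gorder \<Rightarrow> ('e \<Rightarrow> 'f) \<Rightarrow> bool" where
  "lower_lifting P Q F \<longleftrightarrow>
     F ` carrier P = carrier Q \<and>
     (\<forall>p\<in>carrier P. \<forall>q\<in>carrier P. p \<sqsubseteq>\<^bsub>P\<^esub> q \<longrightarrow> F p \<sqsubseteq>\<^bsub>Q\<^esub> F q) \<and>
     (\<forall>q\<in>carrier P. \<forall>s\<in>carrier Q. s \<sqsubseteq>\<^bsub>Q\<^esub> F q \<longrightarrow> (\<exists>p\<in>carrier P. p \<sqsubseteq>\<^bsub>P\<^esub> q \<and> F p = s))"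

definition fibre :: "'e gorder \<Rightarrow> ('e \<Rightarrow> 'f) \<Rightarrow> 'f \<Rightarrow> 'e set" where
  "fibre P F s = {p \<in> carrier P. F p = s}"

text \<open>Weaker than a zipper: nothing is said about the elements below \<open>z\<close>. That
  part becomes available only once all smaller fibres are singletons, whereas the conditions kept
  here survive the zipping of other fibres.\<close>

definition zippable :: "'e gorder \<Rightarrow> 'e set \<Rightarrow> bool" where
  "zippable P T \<longleftrightarrow> (\<exists>x y z. T = {x, y, z} \<and>
     x \<sqsubseteq>\<^bsub>P\<^esub> z \<and> y \<sqsubseteq>\<^bsub>P\<^esub> z \<and> \<not> x \<sqsubseteq>\<^bsub>P\<^esub> y \<and> \<not> y \<sqsubseteq>\<^bsub>P\<^esub> x \<and>
     (\<forall>u\<in>carrier P. x \<sqsubseteq>\<^bsub>P\<^esub> u \<longrightarrow> y \<sqsubseteq>\<^bsub>P\<^esub> u \<longrightarrow> z \<sqsubseteq>\<^bsub>P\<^esub> u))"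

lemma singleton_fibreD:
  assumes "is_singleton (fibre P F s)" "p \<in> carrier P" "q \<in> carrier P" "F p = s" "F q = s"
  shows "p = q"
proof -
  have "p \<in> fibre P F s" "q \<in> fibre P F s" using assms(2-) by (auto simp: fibre_def)
  then show ?thesis using assms(1) by (metis is_singletonE singletonD)
qed

lemma zippableE:
  fixes P (structure)
  assumes "zippable P T"
  obtains x y z where "T = {x, y, z}" "x \<sqsubseteq> z" "y \<sqsubseteq> z" "\<not> x \<sqsubseteq> y" "\<not> y \<sqsubseteq> x"
    "\<And>u. \<lbrakk>u \<in> carrier P; x \<sqsubseteq> u; y \<sqsubseteq> u\<rbrakk> \<Longrightarrow> z \<sqsubseteq> u"
  using assms unfolding zippable_def by metis

text \<open>Order reflection comes from lifting: if \<open>F x\<close> is below \<open>F y\<close>,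
  some \<open>p\<close> below \<open>y\<close> has the image of \<open>x\<close>, and injectivity
  gives \<open>p = x\<close>.\<close>

lemma lower_lifting_inj_iso:
  assumes "partial_order P" "partial_order Q" "lower_lifting P Q F" "inj_on F (carrier P)"
  shows "poset_isomorphic P Q"
proof -
  interpret P: partial_order P by fact
  interpret Q: partial_order Q by fact
  show ?thesis
  proof (rule poset_isomorphicI[of F])
    show "bij_betw F (carrier P) (carrier Q)"
      using assms(3,4) by (simp add: bij_betw_def lower_lifting_def)
    fix x y assume xy: "x \<in> carrier P" "y \<in> carrier P"
    show "F x \<sqsubseteq>\<^bsub>Q\<^esub> F y \<longleftrightarrow> x \<sqsubseteq>\<^bsub>P\<^esub> y"
      using assms(3,4) xy unfolding lower_lifting_def inj_on_def by (metis imageI)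
  qed unfold_locales
qed

text \<open>The zipped fibre collapses to \<open>{w}\<close> and the others stay the same sets.
  Comparisons among old elements are unchanged, so the only new threat to their shape is
  \<open>w\<close> as an upper bound.\<close>

lemma lower_lifting_zip:
  fixes P (structure)
  assumes "zipper_order P x y z w"
    and Q: "partial_order Q"
    and F: "lower_lifting P Q F"
    and fib: "fibre P F t = {x, y, z}"
    and fibs: "\<And>s. s \<in> carrier Q \<Longrightarrow> is_singleton (fibre P F s) \<or> zippable P (fibre P F s)"
  defines "Z \<equiv> zip_poset P x y z w" and "F' \<equiv> F(w := t)"
  shows "lower_lifting Z Q F'"
    and "\<And>s. s \<in> carrier Q \<Longrightarrow> is_singleton (fibre Z F' s) \<or> zippable Z (fibre Z F' s)"
proof -
  interpret zipper_order P x y z w by fact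
  interpret Q: partial_order Q by fact
  note cZ = carrier_Z[folded Z_def] and lZ = le_Z[folded Z_def]
  have Ft: "F x = t" "F y = t" "F z = t" using fib by (auto simp: fibre_def)
  have t: "t \<in> carrier Q" using F Ft carr by (auto simp: lower_lifting_def)
  have Fxyz: "p \<in> {x, y, z} \<longleftrightarrow> F p = t" if "p \<in> carrier P" for p
    using that fib by (auto simp: fibre_def)
  have img: "F p \<in> carrier Q" if "p \<in> carrier P" for p
    using that F by (auto simp: lower_lifting_def)
  have mono: "F p \<sqsubseteq>\<^bsub>Q\<^esub> F q" if "p \<in> carrier P" "q \<in> carrier P" "p \<sqsubseteq> q" for p q
    using that F by (auto simp: lower_lifting_def)
  have lift: "\<exists>p\<in>carrier P. p \<sqsubseteq> q \<and> F p = s" if "q \<in> carrier P" "s \<in> carrier Q" "s \<sqsubseteq>\<^bsub>Q\<^esub> F q" for q s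
    using that F by (auto simp: lower_lifting_def)
  show "lower_lifting Z Q F'"
    unfolding lower_lifting_def
  proof (intro conjI ballI impI)
    show "F' ` carrier Z = carrier Q"
    proof
      show "F' ` carrier Z \<subseteq> carrier Q" using img t by (auto simp: F'_def cZ)
      show "carrier Q \<subseteq> F' ` carrier Z"
      proof
        fix s assume "s \<in> carrier Q"
        then obtain p where p: "p \<in> carrier P" "F p = s"
          using F unfolding lower_lifting_def by (metis imageE)
        show "s \<in> F' ` carrier Z"
        proof (cases "s = t")
          case True
          then show ?thesis by (auto simp: F'_def cZ)
        next
          case False
          then have "p \<in> carrier Z" "F' p = s" using p Fxyz[OF p(1)] fresh by (auto simp: F'_def cZ)
          then show ?thesis by blast
        qed
      qed
    qed
  next
    fix p q assume pq: "p \<in> carrier Z" "q \<in> carrier Z" "p \<sqsubseteq>\<^bsub>Z\<^esub> q"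
    show "F' p \<sqsubseteq>\<^bsub>Q\<^esub> F' q"
    proof (cases "p = w")
      case True
      then show ?thesis using pq t mono[of x q] mono[of y q] carr Ft
        by (auto simp: F'_def cZ lZ)
    next
      case False
      then show ?thesis using pq t mono[of p z] mono[of p q] carr Ft
        by (auto simp: F'_def cZ lZ)
    qed
  next
    fix q s assume qs: "q \<in> carrier Z" "s \<in> carrier Q" "s \<sqsubseteq>\<^bsub>Q\<^esub> F' q"
    \<comment> \<open>The old elements below \<open>w\<close> are those below \<open>z\<close>, so a
      lift below \<open>w\<close> is sought below \<open>z\<close>.\<close>
    define q' where "q' = (if q = w then z else q)"
    have "q' \<in> carrier P" "s \<sqsubseteq>\<^bsub>Q\<^esub> F q'" using qs carr Ft by (auto simp: F'_def cZ q'_def)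
    then obtain p where p: "p \<in> carrier P" "p \<sqsubseteq> q'" "F p = s" using lift qs by blast
    show "\<exists>p\<in>carrier Z. p \<sqsubseteq>\<^bsub>Z\<^esub> q \<and> F' p = s"
    proof (cases "s = t")
      case True
      have "w \<sqsubseteq>\<^bsub>Z\<^esub> q"
      proof (cases "q = w")
        case False
        then have "p \<sqsubseteq> q" "q \<in> carrier P" using p qs by (auto simp: q'_def cZ)
        moreover have "p \<in> {x, y, z}" using Fxyz[OF p(1)] p True by simp
        ultimately have "x \<sqsubseteq> q \<or> y \<sqsubseteq> q" using carr ord le_trans by blast
        then show ?thesis by (simp add: lZ)
      qed (simp add: lZ)
      then show ?thesis using True by (auto simp: F'_def cZ)
    next
      case False
      then have n: "p \<notin> {x, y, z}" using p Fxyz by blast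
      have "p \<noteq> w" using fresh p by blast
      then have "p \<sqsubseteq>\<^bsub>Z\<^esub> q" using p by (auto simp: lZ q'_def)
      then show ?thesis using n p \<open>p \<noteq> w\<close> by (auto simp: F'_def cZ)
    qed
  qed
  fix s assume s: "s \<in> carrier Q"
  show "is_singleton (fibre Z F' s) \<or> zippable Z (fibre Z F' s)"
  proof (cases "s = t")
    case True
    have "fibre Z F' t = {w}"
      using fib fresh by (auto simp: fibre_def F'_def cZ)
    then show ?thesis using True by simp
  next
    case False
    have eq: "fibre Z F' s = fibre P F s"
      using False fib fresh Fxyz by (auto simp: fibre_def F'_def cZ split: if_splits)
    have "zippable Z (fibre P F s)" if zp: "zippable P (fibre P F s)"
    proof -
      obtain x2 y2 z2 where f2: "fibre P F s = {x2, y2, z2}" and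
        o2: "x2 \<sqsubseteq> z2" "y2 \<sqsubseteq> z2" "\<not> x2 \<sqsubseteq> y2" "\<not> y2 \<sqsubseteq> x2"
        "\<And>u. u \<in> carrier P \<Longrightarrow> x2 \<sqsubseteq> u \<Longrightarrow> y2 \<sqsubseteq> u \<Longrightarrow> z2 \<sqsubseteq> u"
        using zippableE[OF zp] by metis
      have c2: "x2 \<in> carrier P" "y2 \<in> carrier P" "z2 \<in> carrier P"
        using f2 by (auto simp: fibre_def)
      then have "x2 \<noteq> w" "y2 \<noteq> w" "z2 \<noteq> w" using fresh by auto
      \<comment> \<open>For \<open>u = w\<close> both \<open>x2\<close> and \<open>y2\<close> lie
        below \<open>z\<close>, hence so does \<open>z2\<close>, which means that \<open>z2\<close>
        is below \<open>w\<close>.\<close>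
      moreover have "z2 \<sqsubseteq>\<^bsub>Z\<^esub> u" if "u \<in> carrier Z" "x2 \<sqsubseteq>\<^bsub>Z\<^esub> u" "y2 \<sqsubseteq>\<^bsub>Z\<^esub> u" for u
        using that calculation o2(5)[of u] o2(5)[of z] carr by (auto simp: lZ cZ split: if_splits)
      ultimately show ?thesis
        unfolding zippable_def f2 using o2 by (intro exI[of _ x2] exI[of _ y2] exI[of _ z2]) (auto simp: lZ)
    qed
    then show ?thesis using fibs[OF s] eq by auto
  qed
qed

theorem zip_along_lower_lifting:
  fixes P :: "'e gorder" and Q :: "'f gorder"
  assumes "partial_order P" "finite (carrier P)" "carrier P \<noteq> UNIV"
    and "partial_order Q"
    and "lower_lifting P Q F"
    and "\<And>s. s \<in> carrier Q \<Longrightarrow> is_singleton (fibre P F s) \<or> zippable P (fibre P F s)"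
  shows "\<exists>P'. (\<lambda>P P'. partial_order P' \<and> zip_step P P')\<^sup>*\<^sup>* P P' \<and> partial_order P' \<and>
    finite (carrier P') \<and> carrier P' \<noteq> UNIV \<and> poset_isomorphic P' Q"
  using assms
proof (induction "card (carrier P)" arbitrary: P F rule: less_induct)
  case less
  interpret P: partial_order P by fact
  interpret Q: partial_order Q by fact
  note F = \<open>lower_lifting P Q F\<close>
  have finQ: "finite (carrier Q)"
    using F less.prems(2) unfolding lower_lifting_def by (metis finite_imageI)
  define T where "T = {s \<in> carrier Q. \<not> is_singleton (fibre P F s)}"
  show ?case
  proof (cases "T = {}")
    case True
    have "inj_on F (carrier P)"
    proof (rule inj_onI)
      fix p q assume pq: "p \<in> carrier P" "q \<in> carrier P" "F p = F q"
      then have "F p \<in> carrier Q" using F by (auto simp: lower_lifting_def)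
      then have "is_singleton (fibre P F (F p))" using True by (auto simp: T_def)
      then show "p = q" by (rule singleton_fibreD) (use pq in auto)
    qed
    then have "poset_isomorphic P Q"
      using lower_lifting_inj_iso less.prems by blast
    then show ?thesis using less.prems by blast
  next
    case False
    \<comment> \<open>All fibres strictly below a minimal nonsingleton one are singletons, which is
      what turns \<open>zippable\<close> into a zipper.\<close>
    then obtain t where t: "t \<in> T" "\<And>s. s \<in> T \<Longrightarrow> s \<sqsubseteq>\<^bsub>Q\<^esub> t \<Longrightarrow> s = t"
      using Q.finite_has_minimal[of T] finQ by (auto simp: T_def)
    then have tQ: "t \<in> carrier Q" and zp: "zippable P (fibre P F t)"
      using less.prems(6) by (auto simp: T_def)
    then obtain x y z where fib: "fibre P F t = {x, y, z}" and
        o: "x \<sqsubseteq>\<^bsub>P\<^esub> z" "y \<sqsubseteq>\<^bsub>P\<^esub> z" "\<not> x \<sqsubseteq>\<^bsub>P\<^esub> y" "\<not> y \<sqsubseteq>\<^bsub>P\<^esub> x"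
        "\<And>u. u \<in> carrier P \<Longrightarrow> x \<sqsubseteq>\<^bsub>P\<^esub> u \<Longrightarrow> y \<sqsubseteq>\<^bsub>P\<^esub> u \<Longrightarrow> z \<sqsubseteq>\<^bsub>P\<^esub> u"
      using zippableE[OF zp] by metis
    have c: "x \<in> carrier P" "y \<in> carrier P" "z \<in> carrier P" and Ft: "F x = t" "F y = t" "F z = t"
      using fib by (auto simp: fibre_def)
    obtain w where w: "w \<notin> carrier P" using less.prems(3) by blast
    \<comment> \<open>An element under \<open>z\<close> outside the fibre has its image strictly
      below \<open>t\<close>, where fibres are singletons. Lifting that image below
      \<open>x'\<close> therefore returns the same element.\<close>
    have below: "p \<sqsubseteq>\<^bsub>P\<^esub> x'" if p: "p \<in> carrier P" "p \<sqsubseteq>\<^bsub>P\<^esub> z" "p \<notin> {x, y, z}" and x': "x' \<in> carrier P" "F x' = t" for p x'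
    proof -
      have Fp: "F p \<in> carrier Q" "F p \<sqsubseteq>\<^bsub>Q\<^esub> t" 
        using F p(1,2) c Ft unfolding lower_lifting_def by (blast, metis)
      moreover have "F p \<noteq> t" using p fib by (auto simp: fibre_def)
      ultimately have "F p \<notin> T" using t(2) by blast
      then have sing: "is_singleton (fibre P F (F p))" using Fp by (simp add: T_def)
      obtain q where "q \<in> carrier P" "q \<sqsubseteq>\<^bsub>P\<^esub> x'" "F q = F p"
        using F x' Fp unfolding lower_lifting_def by metis
      then show ?thesis using singleton_fibreD[OF sing p(1)] by metis
    qed
    interpret zipper_order P x y z w
      by unfold_locales (use c o w below Ft in auto)
    have lt: "card (carrier Z) < card (carrier P)"
    proof -
      have "card (carrier Z) \<le> Suc (card (carrier P - {x, y, z}))"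
        by (simp add: carrier_Z card_insert_le_m1 card_insert_if less.prems(2))
      also have "card (carrier P - {x, y, z}) = card (carrier P) - 3"
        using carr distinct by (subst card_Diff_subset) auto
      also have "Suc (card (carrier P) - 3) < card (carrier P)"
        using card_mono[of "carrier P" "{x, y, z}"] less.prems(2) carr distinct by auto
      finally show ?thesis .
    qed
    have zo: "zipper_order P x y z w" by unfold_locales
    \<comment> \<open>The discarded \<open>x\<close> lies outside \<open>Z\<close> and leaves room
      for the new element of the next zip.\<close>
    have "x \<notin> carrier Z" using fresh carr by (auto simp: carrier_Z)
    then obtain P' where P': "(\<lambda>P P'. partial_order P' \<and> zip_step P P')\<^sup>*\<^sup>* Z P'" "partial_order P'"
        "finite (carrier P')" "carrier P' \<noteq> UNIV" "poset_isomorphic P' Q"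
      using less.hyps[OF lt partial_order_Z _ _ less.prems(4) lower_lifting_zip[OF zo less.prems(4) F fib less.prems(6)]]
        less.prems(2) by (auto simp: carrier_Z)
    then show ?thesis
      using converse_rtranclp_into_rtranclp[of "\<lambda>P P'. partial_order P' \<and> zip_step P P'" P Z P']
        partial_order_Z zip_step by blast
  qed
qed

section \<open>Minors as pairs\<close>

text \<open>The carrier of the span of \<open>A\<close> over \<open>z\<close>, with joins formed one
  generator at a time so that rule induction applies. \<open>jspan_eq\<close> recovers the
  description by joins of subsets.\<close>

inductive_set jspan :: "'a gorder \<Rightarrow> 'a \<Rightarrow> 'a set \<Rightarrow> 'a set" for L (structure) and z A where
  base: "z \<in> jspan L z A"
| step: "u \<in> jspan L z A \<Longrightarrow> h \<in> A \<Longrightarrow> u \<squnion> h \<in> jspan L z A"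

text \<open>Encodes one contraction, moving the minimum to an element of the span, followed by one
  deletion of generators. That iterating gives nothing more is \<open>ple_trans\<close>.\<close>

definition ple :: "'a gorder \<Rightarrow> 'a \<times> 'a set \<Rightarrow> 'a \<times> 'a set \<Rightarrow> bool" where
  "ple L p q \<longleftrightarrow> fst p \<in> jspan L (fst q) (snd q) \<and>
     snd p \<subseteq> (\<lambda>h. h \<squnion>\<^bsub>L\<^esub> fst p) ` snd q - {fst p}"

text \<open>The pair \<open>(z, A)\<close> stands for the minor $\langle A|z\rangle$.\<close>

definition pair_poset :: "'a gorder \<Rightarrow> 'a set \<Rightarrow> ('a \<times> 'a set) option gorder" where
  "pair_poset L G =
     \<lparr>carrier = insert None (Some ` {p. ple L p (\<bottom>\<^bsub>L\<^esub>, G)}),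
      eq = (=),
      le = (\<lambda>p q. case p of None \<Rightarrow> True
                 | Some p' \<Rightarrow> (case q of None \<Rightarrow> False | Some q' \<Rightarrow> ple L p' q'))\<rparr>"

lemma pair_poset_simps [simp]:
  "None \<in> carrier (pair_poset L G)"
  "Some p \<in> carrier (pair_poset L G) \<longleftrightarrow> ple L p (\<bottom>\<^bsub>L\<^esub>, G)"
  "None \<sqsubseteq>\<^bsub>pair_poset L G\<^esub> s"
  "\<not> Some p \<sqsubseteq>\<^bsub>pair_poset L G\<^esub> None"
  "Some p \<sqsubseteq>\<^bsub>pair_poset L G\<^esub> Some q \<longleftrightarrow> ple L p q"
  by (auto simp: pair_poset_def)

lemma (in partial_order) sup_eqI:
  assumes "least L s (Upper L X)"
  shows "\<Squnion>X = s"
  unfolding sup_def using assms by (rule some_equality) (rule least_unique[OF _ assms])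

lemma (in partial_order) bottom_eqI:
  assumes "b \<in> carrier L" "\<And>x. x \<in> carrier L \<Longrightarrow> b \<sqsubseteq> x"
  shows "\<bottom> = b"
proof -
  have "least L b (carrier L)" using assms by (simp add: least_def)
  then show ?thesis unfolding bottom_def by (metis some_equality least_unique)
qed

section \<open>Joins, spans and the order on pairs in a finite lattice\<close>

locale finite_lattice = lattice L for L :: "'a gorder" (structure) +
  assumes finite_carrier: "finite (carrier L)"
    and carrier_nonempty: "carrier L \<noteq> {}"
begin

lemma join_le_iff [simp]:
  "\<lbrakk>x \<in> carrier L; y \<in> carrier L; u \<in> carrier L\<rbrakk> \<Longrightarrow> x \<squnion> y \<sqsubseteq> u \<longleftrightarrow> x \<sqsubseteq> u \<and> y \<sqsubseteq> u"
  by (meson join_closed join_le join_left join_right le_trans)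

lemma join_absorb:
  "\<lbrakk>x \<in> carrier L; y \<in> carrier L; y \<sqsubseteq> x\<rbrakk> \<Longrightarrow> x \<squnion> y = x"
  by (simp add: join_left le_antisym)

lemma join_absorb':
  "\<lbrakk>x \<in> carrier L; y \<in> carrier L; x \<sqsubseteq> y\<rbrakk> \<Longrightarrow> x \<squnion> y = y"
  using le_iff_meet by blast

lemma bottom_least': "least L \<bottom> (carrier L)"
proof -
  obtain b where b: "b \<in> carrier L" "\<And>s. s \<in> carrier L \<Longrightarrow> s \<sqsubseteq> b \<Longrightarrow> s = b"
    using finite_has_minimal[OF finite_carrier order_refl carrier_nonempty] by blast
  have "b \<sqsubseteq> x" if x: "x \<in> carrier L" for x
  proof -
    have "b \<sqinter> x = b" using b x by (simp add: meet_left)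
    then show ?thesis using meet_right[OF b(1) x] by simp
  qed
  then show ?thesis using bottom_eqI b(1) by (simp add: least_def)
qed

lemma bottom_closed' [simp]: "\<bottom> \<in> carrier L"
  using bottom_least' by (simp add: least_def)

lemma bottom_lower' [simp]: "x \<in> carrier L \<Longrightarrow> \<bottom> \<sqsubseteq> x"
  using bottom_least' by (simp add: least_def)

lemma sup_lub':
  assumes "X \<subseteq> carrier L"
  shows "least L (\<Squnion>X) (Upper L X)"
proof (cases "X = {}")
  case True
  then show ?thesis using sup_eqI[of \<bottom> "{}"] bottom_least' by simp
next
  case False
  then show ?thesis using assms finite_sup_least finite_subset[OF assms finite_carrier] by blast
qed

lemma sup_closed' [simp]: "X \<subseteq> carrier L \<Longrightarrow> \<Squnion>X \<in> carrier L"
  using sup_lub' by (rule least_closed)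

lemma sup_le_iff:
  assumes "X \<subseteq> carrier L" "u \<in> carrier L"
  shows "\<Squnion>X \<sqsubseteq> u \<longleftrightarrow> (\<forall>x\<in>X. x \<sqsubseteq> u)"
proof
  assume "\<Squnion>X \<sqsubseteq> u"
  then show "\<forall>x\<in>X. x \<sqsubseteq> u"
    using assms least_Upper_above[OF sup_lub'[OF assms(1)] _ assms(1)]
    by (metis le_trans subsetD sup_closed')
next
  assume "\<forall>x\<in>X. x \<sqsubseteq> u"
  then show "\<Squnion>X \<sqsubseteq> u"
    by (intro least_le[OF sup_lub'[OF assms(1)]] Upper_memI) (use assms in auto)
qed

lemma sup_empty: "\<Squnion>{} = \<bottom>"
  using sup_eqI[of \<bottom> "{}"] bottom_least' by simp

text \<open>Turns identities between joins into comparisons of upper bounds, which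
  \<open>join_le_iff\<close> and \<open>sup_le_iff\<close> reduce to plain inequalities.\<close>

lemma eqI_le:
  assumes "x \<in> carrier L" "y \<in> carrier L" "\<And>u. u \<in> carrier L \<Longrightarrow> x \<sqsubseteq> u \<longleftrightarrow> y \<sqsubseteq> u"
  shows "x = y"
  using assms le_antisym le_refl by blast

lemma sup_insert:
  assumes "h \<in> carrier L" "X \<subseteq> carrier L"
  shows "\<Squnion>(insert h X) = \<Squnion>X \<squnion> h"
  using assms by (intro eqI_le) (auto simp: sup_le_iff)

lemma join_sup_insert:
  assumes "z \<in> carrier L" "h \<in> carrier L" "X \<subseteq> carrier L"
  shows "z \<squnion> \<Squnion>(insert h X) = (z \<squnion> \<Squnion>X) \<squnion> h"
  using assms by (subst sup_insert) (auto simp: join_assoc)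

lemma jspan_closed:
  assumes "z \<in> carrier L" "A \<subseteq> carrier L" "u \<in> jspan L z A"
  shows "u \<in> carrier L \<and> z \<sqsubseteq> u"
  using assms(3)
proof induction
  case base
  then show ?case using assms by simp
next
  case (step u h)
  then show ?case using assms join_left le_trans
    by (meson join_closed subset_iff)
qed

lemma jspan_eq:
  assumes "z \<in> carrier L" "A \<subseteq> carrier L"
  shows "jspan L z A = {z \<squnion> \<Squnion>X | X. X \<subseteq> A}"
proof (intro equalityI subsetI)
  fix u assume "u \<in> jspan L z A"
  then show "u \<in> {z \<squnion> \<Squnion>X | X. X \<subseteq> A}"
  proof induction
    case base
    have "z = z \<squnion> \<Squnion>{}" using assms by (simp add: sup_empty join_absorb)
    then show ?case by blast
  next
    case (step u h)
    then obtain X where X: "X \<subseteq> A" "u = z \<squnion> \<Squnion>X" by blast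
    have "h \<in> carrier L" "X \<subseteq> carrier L" using X step(2) assms by auto
    then have "u \<squnion> h = z \<squnion> \<Squnion>(insert h X)"
      using join_sup_insert assms(1) X(2) by simp
    then show ?case using X step(2) by blast
  qed
next
  fix u assume "u \<in> {z \<squnion> \<Squnion>X | X. X \<subseteq> A}"
  then obtain X where X: "X \<subseteq> A" "u = z \<squnion> \<Squnion>X" by blast
  have "finite X" using X assms finite_carrier by (meson finite_subset)
  then have "z \<squnion> \<Squnion>X \<in> jspan L z A" using X(1)
  proof induction
    case empty
    then show ?case using assms by (simp add: sup_empty join_absorb jspan.base)
  next
    case (insert h X)
    have "z \<squnion> \<Squnion>(insert h X) = (z \<squnion> \<Squnion>X) \<squnion> h"
      using insert assms by (intro join_sup_insert) auto
    then show ?case using insert by (auto intro: jspan.step)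
  qed
  then show "u \<in> jspan L z A" using X by simp
qed

text \<open>An element of \<open>B\<close> is \<open>g \<squnion> z'\<close> with \<open>g\<close>
  in \<open>A\<close>, and \<open>z'\<close> is already below every element reached, so joining with
  it amounts to joining with \<open>g\<close>.\<close>

lemma jspan_trans:
  assumes "z \<in> carrier L" "A \<subseteq> carrier L" "z' \<in> jspan L z A"
    and B: "B \<subseteq> (\<lambda>h. h \<squnion> z') ` A" and w: "w \<in> jspan L z' B"
  shows "w \<in> jspan L z A"
  using w
proof induction
  case base
  then show ?case by fact
next
  case (step u h)
  then obtain g where g: "g \<in> A" "h = g \<squnion> z'" using B by blast
  have z': "z' \<in> carrier L" using jspan_closed assms by blast
  have "B \<subseteq> carrier L" by (rule subset_trans[OF B]) (use z' assms(2) in auto)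
  then have "u \<in> carrier L" "z' \<sqsubseteq> u" using jspan_closed[OF z' _ step(1)] by auto
  moreover have "g \<in> carrier L" using g assms(2) by blast
  ultimately have "u \<squnion> h = u \<squnion> g" using z'
    by (intro eqI_le) (auto simp: g(2) intro: le_trans)
  then show ?case using jspan.step[OF step(3) g(1)] by simp
qed

lemma jspan_join:
  assumes "z \<in> carrier L" "A \<subseteq> carrier L" "u \<in> jspan L z A" "v \<in> jspan L z A"
  shows "u \<squnion> v \<in> jspan L z A"
  using assms(4)
proof induction
  case base
  then show ?case using assms jspan_closed[OF assms(1-3)] by (simp add: join_absorb)
next
  case (step v h)
  have "u \<squnion> (v \<squnion> h) = (u \<squnion> v) \<squnion> h"
    using step jspan_closed[OF assms(1-3)] jspan_closed[OF assms(1,2) step(1)] assms(2)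
    by (subst join_assoc) auto
  then show ?case using step(3,2) jspan.step by metis
qed

lemma jspan_Sup:
  assumes "z \<in> carrier L" "A \<subseteq> carrier L" "X \<subseteq> jspan L z A"
  shows "z \<squnion> \<Squnion>X \<in> jspan L z A"
proof -
  have X: "X \<subseteq> carrier L" using assms jspan_closed by blast
  then have "finite X" using finite_carrier finite_subset by blast
  then show ?thesis using assms(3)
  proof induction
    case empty
    then show ?case using assms by (simp add: sup_empty join_absorb jspan.base)
  next
    case (insert h X)
    then have c: "X \<subseteq> carrier L" "h \<in> carrier L" using jspan_closed assms by blast+
    then have "z \<squnion> \<Squnion>(insert h X) = (z \<squnion> \<Squnion>X) \<squnion> h"
      using assms by (intro join_sup_insert) auto
    moreover have "(z \<squnion> \<Squnion>X) \<squnion> h \<in> jspan L z A"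
      by (rule jspan_join[OF assms(1,2)]) (use insert in simp_all)
    ultimately show ?case by simp
  qed
qed

text \<open>The side condition under which \<open>span_from\<close> is meaningful. It makes joining
  a generator with the minimum trivial, on which reflexivity and antisymmetry of \<open>ple\<close>
  rest.\<close>

definition valid :: "'a \<times> 'a set \<Rightarrow> bool" where
  "valid p \<longleftrightarrow> fst p \<in> carrier L \<and> snd p \<subseteq> carrier L \<and> (\<forall>h\<in>snd p. fst p \<sqsubset> h)"

lemma ple_valid:
  assumes "ple L p q" "fst q \<in> carrier L" "snd q \<subseteq> carrier L"
  shows "valid p"
proof -
  have z: "fst p \<in> carrier L" using assms jspan_closed unfolding ple_def by blast
  have "h \<in> carrier L \<and> fst p \<sqsubset> h" if h: "h \<in> snd p" for h
  proof -
    obtain g where g: "g \<in> snd q" "h = g \<squnion> fst p" "h \<noteq> fst p"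
      using h assms(1) unfolding ple_def by blast
    then have "g \<in> carrier L" using assms by blast
    then show ?thesis using z g join_right[of g "fst p"] by (simp add: lless_iff)
  qed
  then show ?thesis unfolding valid_def using z by auto
qed

lemma ple_refl: "valid p \<Longrightarrow> ple L p p"
proof -
  assume v: "valid p"
  have "h \<in> (\<lambda>h. h \<squnion> fst p) ` snd p - {fst p}" if h: "h \<in> snd p" for h
  proof -
    have "h \<squnion> fst p = h" "h \<noteq> fst p" using v h unfolding valid_def lless_iff
      by (auto intro: join_absorb)
    then show ?thesis using h by (metis DiffI imageI singletonD)
  qed
  then show ?thesis unfolding ple_def using jspan.base by auto
qed

text \<open>Generators compose because
  \<open>(k \<squnion> fst q) \<squnion> fst p = k \<squnion> fst p\<close> as soon as
  \<open>fst q\<close> lies below \<open>fst p\<close>.\<close>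

lemma ple_trans:
  assumes pq: "ple L p q" and qr: "ple L q r" and r: "fst r \<in> carrier L" "snd r \<subseteq> carrier L"
  shows "ple L p r"
proof -
  have v: "fst q \<in> carrier L" "snd q \<subseteq> carrier L" using ple_valid[OF qr r] by (auto simp: valid_def)
  have z: "fst q \<sqsubseteq> fst p" "fst p \<in> carrier L" using pq jspan_closed[OF v] by (auto simp: ple_def)
  have "fst p \<in> jspan L (fst r) (snd r)"
    using pq qr jspan_trans[OF r] unfolding ple_def by blast
  moreover have "h \<in> (\<lambda>h. h \<squnion> fst p) ` snd r" if h: "h \<in> snd p" for h
  proof -
    obtain g where g: "g \<in> snd q" "h = g \<squnion> fst p" using h pq unfolding ple_def by blast
    then obtain k where k: "k \<in> snd r" "g = k \<squnion> fst q" using qr unfolding ple_def by blast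
    have kc: "k \<in> carrier L" using k r by auto
    have "h = k \<squnion> fst p"
      using g k kc z v by (intro eqI_le) (auto intro: le_trans)
    then show ?thesis using k by blast
  qed
  ultimately show ?thesis using pq unfolding ple_def by blast
qed

lemma ple_antisym:
  assumes "ple L p q" "ple L q p" "valid p" "valid q"
  shows "p = q"
proof -
  have c: "fst p \<in> carrier L" "snd p \<subseteq> carrier L" "fst q \<in> carrier L" "snd q \<subseteq> carrier L"
    using assms by (auto simp: valid_def)
  have z: "fst p = fst q"
    using assms jspan_closed[OF c(1,2)] jspan_closed[OF c(3,4)] c le_antisym unfolding ple_def by blast
  have "h \<squnion> fst q = h" if "h \<in> snd p \<union> snd q" for h
    using that assms(3,4) c z unfolding valid_def by (intro join_absorb) (auto simp: lless_iff)
  then have "snd p = snd q" using assms(1,2) z unfolding ple_def by auto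
  then show ?thesis using z by (simp add: prod_eq_iff)
qed

text \<open>With a common minimum the contraction is trivial and only deletion remains.\<close>

lemma ple_subset:
  assumes "valid (s, A)" "valid (s, B)"
  shows "ple L (s, A) (s, B) \<longleftrightarrow> A \<subseteq> B"
proof -
  have "(\<lambda>h. h \<squnion> s) ` B - {s} = B"
  proof -
    have "h \<squnion> s = h \<and> h \<noteq> s" if "h \<in> B" for h
      using that assms by (auto simp: valid_def lless_iff intro!: join_absorb)
    then have "(\<lambda>h. h \<squnion> s) ` B = B" "s \<notin> B" by (simp_all cong: image_cong) blast
    then show ?thesis by simp
  qed
  then show ?thesis by (simp add: ple_def jspan.base)
qed

end

sublocale gen_enriched_lattice \<subseteq> finite_lattice
  by unfold_locales (rule finite_carrier carrier_nonempty)+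

lemma gen_enriched_latticeI:
  assumes "finite_lattice L" "G \<subseteq> carrier L - {\<bottom>\<^bsub>L\<^esub>}" "carrier L \<subseteq> jspan L \<bottom>\<^bsub>L\<^esub> G"
  shows "gen_enriched_lattice L G"
proof -
  interpret finite_lattice L by fact
  have G: "G \<subseteq> carrier L" using assms by auto
  have "\<exists>X\<subseteq>G. x = \<Squnion>\<^bsub>L\<^esub>X" if x: "x \<in> carrier L" for x
  proof -
    have "x \<in> jspan L \<bottom>\<^bsub>L\<^esub> G" using x assms(3) by blast
    then obtain X where X: "X \<subseteq> G" "x = \<bottom>\<^bsub>L\<^esub> \<squnion>\<^bsub>L\<^esub> \<Squnion>\<^bsub>L\<^esub>X"
      unfolding jspan_eq[OF bottom_closed' G] by blast
    then have "x = \<Squnion>\<^bsub>L\<^esub>X" using G by (simp add: join_absorb')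
    then show ?thesis using X by blast
  qed
  then show ?thesis using assms(2) finite_carrier carrier_nonempty by unfold_locales auto
qed

context gen_enriched_lattice
begin

lemma G_closed: "G \<subseteq> carrier L"
  using generators by auto

lemma jspan_bottom: "jspan L \<bottom> G = carrier L"
proof -
  have "x \<in> jspan L \<bottom> G" if x: "x \<in> carrier L" for x
  proof -
    obtain X where X: "X \<subseteq> G" "x = \<Squnion>X" using generates x by blast
    then have "x = \<bottom> \<squnion> \<Squnion>X" using G_closed by (simp add: join_absorb')
    then show ?thesis using X unfolding jspan_eq[OF bottom_closed' G_closed] by blast
  qed
  then show ?thesis using jspan_closed[OF bottom_closed' G_closed] by blast
qed

definition contracted :: "'a \<Rightarrow> 'a set" where
  "contracted z = (\<lambda>g. g \<squnion> z) ` G - {z}"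

text \<open>Since \<open>G\<close> generates \<open>L\<close>, every element of \<open>L\<close> is
  the minimum of some minor, and only the generators are constrained.\<close>

lemma ple_top: "ple L p (\<bottom>, G) \<longleftrightarrow> fst p \<in> carrier L \<and> snd p \<subseteq> contracted (fst p)"
  by (simp add: ple_def jspan_bottom contracted_def)

lemma pair_valid: "ple L p (\<bottom>, G) \<Longrightarrow> valid p"
  using ple_valid[of p "(\<bottom>, G)"] G_closed by simp

lemma valid_top: "valid (\<bottom>, G)"
  using generators by (auto simp: valid_def lless_iff)

lemma partial_order_pair_poset: "partial_order (pair_poset L G)"
proof -
  have eqP: "eq (pair_poset L G) = (=)" by (simp add: pair_poset_def)
  have refl: "s \<sqsubseteq>\<^bsub>pair_poset L G\<^esub> s" if "s \<in> carrier (pair_poset L G)" for s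
    using that by (cases s) (auto intro: ple_refl pair_valid)
  have antisym: "s = t" if "s \<in> carrier (pair_poset L G)" "t \<in> carrier (pair_poset L G)"
    "s \<sqsubseteq>\<^bsub>pair_poset L G\<^esub> t" "t \<sqsubseteq>\<^bsub>pair_poset L G\<^esub> s" for s t
  proof -
    have "p = q" if "ple L p (\<bottom>, G)" "ple L q (\<bottom>, G)" "ple L p q" "ple L q p" for p q
      using ple_antisym[OF that(3,4)] that(1,2) pair_valid by blast
    then show ?thesis using that by (cases s; cases t) (simp_all del: split_paired_All)
  qed
  have trans: "s \<sqsubseteq>\<^bsub>pair_poset L G\<^esub> u" if "s \<sqsubseteq>\<^bsub>pair_poset L G\<^esub> t" "t \<sqsubseteq>\<^bsub>pair_poset L G\<^esub> u"
    "u \<in> carrier (pair_poset L G)" for s t u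
  proof -
    have tr: "ple L p r" if "ple L p q" "ple L q r" "ple L r (\<bottom>, G)" for p q r
      using ple_trans[OF that(1,2)] pair_valid[OF that(3)] by (auto simp: valid_def)
    show ?thesis using that by (cases s; cases t; cases u) (auto intro: tr simp del: split_paired_All)
  qed
  show ?thesis
    by unfold_locales (use refl antisym in \<open>simp_all add: eqP\<close>, use trans in blast)
qed

lemma finite_pair_poset: "finite (carrier (pair_poset L G))"
proof -
  have "{p. ple L p (\<bottom>, G)} \<subseteq> carrier L \<times> Pow (carrier L)"
    using pair_valid by (fastforce simp: valid_def)
  then have "finite {p. ple L p (\<bottom>, G)}"
    by (rule finite_subset) (simp add: finite_carrier)
  then show ?thesis by (simp add: pair_poset_def)
qed

end

section \<open>Maps of minors induced by strong surjections\<close>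

text \<open>Generators that \<open>f\<close> sends to the new minimum have to disappear for the
  image to be a valid pair.\<close>

definition pair_map :: "('a \<Rightarrow> 'b) \<Rightarrow> 'a \<times> 'a set \<Rightarrow> 'b \<times> 'b set" where
  "pair_map f p = (f (fst p), f ` snd p - {f (fst p)})"

locale strong_surj = L: gen_enriched_lattice L G + K: gen_enriched_lattice K H
  for L :: "'a gorder" and G :: "'a set" and K :: "'b gorder" and H :: "'b set" +
  fixes f :: "'a \<Rightarrow> 'b"
  assumes surj: "strong_surjection L G K H f"
begin

lemma f_closed: "x \<in> carrier L \<Longrightarrow> f x \<in> carrier K"
  using surj by (auto simp: strong_surjection_def strong_map_def)

lemma f_join: "\<lbrakk>x \<in> carrier L; y \<in> carrier L\<rbrakk> \<Longrightarrow> f (x \<squnion>\<^bsub>L\<^esub> y) = f x \<squnion>\<^bsub>K\<^esub> f y"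
  using surj by (auto simp: strong_surjection_def strong_map_def join_pres_def)

lemma f_mono: "\<lbrakk>x \<in> carrier L; y \<in> carrier L; x \<sqsubseteq>\<^bsub>L\<^esub> y\<rbrakk> \<Longrightarrow> f x \<sqsubseteq>\<^bsub>K\<^esub> f y"
  using f_join[of x y] by (simp add: L.join_absorb' K.join_left f_closed)
    (metis K.join_left f_closed)

text \<open>The surjectivity of \<open>f\<close> on generators enters here; surjectivity on all
  minors then comes from lifting below this top pair.\<close>

lemma pair_map_top: "pair_map f (\<bottom>\<^bsub>L\<^esub>, G) = (\<bottom>\<^bsub>K\<^esub>, H)"
proof -
  have "f \<bottom>\<^bsub>L\<^esub> = \<bottom>\<^bsub>K\<^esub>" "f ` G \<union> {\<bottom>\<^bsub>K\<^esub>} = H \<union> {\<bottom>\<^bsub>K\<^esub>}"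
    using surj by (auto simp: strong_surjection_def strong_map_def)
  then show ?thesis using K.generators by (auto simp: pair_map_def)
qed

lemma jspan_image:
  assumes "z \<in> carrier L" "A \<subseteq> carrier L" "u \<in> jspan L z A"
  shows "f u \<in> jspan K (f z) (f ` A - {f z})"
  using assms(3)
proof induction
  case base
  then show ?case by (rule jspan.base)
next
  case (step u h)
  have u: "u \<in> carrier L" "z \<sqsubseteq>\<^bsub>L\<^esub> u" using L.jspan_closed[OF assms(1,2) step(1)] by auto
  have h: "h \<in> carrier L" using step assms by auto
  have eq: "f (u \<squnion>\<^bsub>L\<^esub> h) = f u \<squnion>\<^bsub>K\<^esub> f h" using u h f_join by simp
  show ?case
  proof (cases "f h = f z")
    case True
    then have "f (u \<squnion>\<^bsub>L\<^esub> h) = f u" using eq u f_mono[of z u] assms h f_closed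
      by (simp add: K.join_absorb)
    then show ?thesis using step by simp
  next
    case False
    then show ?thesis unfolding eq using step by (intro jspan.step) auto
  qed
qed

lemma jspan_lift:
  assumes "z \<in> carrier L" "A \<subseteq> carrier L" "v \<in> jspan K (f z) (f ` A - {f z})"
  shows "\<exists>u\<in>jspan L z A. f u = v"
  using assms(3)
proof induction
  case base
  show ?case by (rule bexI[of _ z]) (rule HOL.refl jspan.base)+
next
  case (step v k)
  obtain u where u: "u \<in> jspan L z A" "f u = v" using step(3) by blast
  obtain h where h: "h \<in> A" "k = f h" using step(2) by blast
  have "f (u \<squnion>\<^bsub>L\<^esub> h) = v \<squnion>\<^bsub>K\<^esub> k"
    using L.jspan_closed[OF assms(1,2) u(1)] assms(2) f_join u h by auto
  moreover have "u \<squnion>\<^bsub>L\<^esub> h \<in> jspan L z A" using u(1) h(1) by (rule jspan.step)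
  ultimately show ?case by blast
qed

lemma pair_map_mono:
  assumes "ple L p q" "fst q \<in> carrier L" "snd q \<subseteq> carrier L"
  shows "ple K (pair_map f p) (pair_map f q)"
proof -
  have p: "fst p \<in> carrier L" "fst q \<sqsubseteq>\<^bsub>L\<^esub> fst p"
    using L.jspan_closed[OF assms(2,3)] assms(1) unfolding ple_def by auto
  have "f h \<in> (\<lambda>k. k \<squnion>\<^bsub>K\<^esub> f (fst p)) ` (f ` snd q - {f (fst q)})"
    if h: "h \<in> snd p" "f h \<noteq> f (fst p)" for h
  proof -
    obtain g where g: "g \<in> snd q" "h = g \<squnion>\<^bsub>L\<^esub> fst p"
      using h(1) assms(1) unfolding ple_def by blast
    then have eq: "f h = f g \<squnion>\<^bsub>K\<^esub> f (fst p)" using f_join p assms(3) by auto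
    \<comment> \<open>A surviving generator comes from a surviving one: if \<open>f g\<close> were
      the old minimum, \<open>g \<squnion> fst p\<close> would be sent to the new minimum and be
      dropped too.\<close>
    have "f g \<noteq> f (fst q)"
    proof
      assume "f g = f (fst q)"
      then have "f h = f (fst p)" using eq p assms(2) f_mono f_closed by (simp add: K.join_absorb')
      then show False using h by simp
    qed
    then show ?thesis using g eq by blast
  qed
  then show ?thesis
    using jspan_image[OF assms(2,3)] assms(1) unfolding ple_def pair_map_def by auto
qed

lemma pair_map_lift:
  assumes "fst q \<in> carrier L" "snd q \<subseteq> carrier L" "ple K s (pair_map f q)"
  shows "\<exists>p. ple L p q \<and> pair_map f p = s"
proof -
  obtain z where z: "z \<in> jspan L (fst q) (snd q)" "f z = fst s"
    using jspan_lift[OF assms(1,2)] assms(3) unfolding ple_def pair_map_def by auto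
  have zc: "z \<in> carrier L" using z L.jspan_closed assms by blast
  \<comment> \<open>The largest possible choice: every generator of the contraction to
    \<open>z\<close> with image in \<open>snd s\<close>. It omits \<open>z\<close>, as
    \<open>f z\<close> is not in \<open>snd s\<close>.\<close>
  define A where "A = {h \<in> (\<lambda>g. g \<squnion>\<^bsub>L\<^esub> z) ` snd q. f h \<in> snd s}"
  have s: "snd s \<subseteq> (\<lambda>k. k \<squnion>\<^bsub>K\<^esub> f z) ` (f ` snd q - {f (fst q)})" "f z \<notin> snd s"
    using assms(3) z unfolding ple_def pair_map_def by auto
  have "k \<in> f ` A" if k: "k \<in> snd s" for k
  proof -
    obtain g where g: "g \<in> snd q" "k = f g \<squnion>\<^bsub>K\<^esub> f z" using s k by blast
    then have "k = f (g \<squnion>\<^bsub>L\<^esub> z)" using f_join zc assms(2) by auto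
    then show ?thesis using g k unfolding A_def by blast
  qed
  then have "f ` A = snd s" by (auto simp: A_def)
  then have "pair_map f (z, A) = s" using s z by (simp add: pair_map_def prod_eq_iff)
  moreover have "ple L (z, A) q" using z s by (auto simp: ple_def A_def)
  ultimately show ?thesis by blast
qed

lemma lower_lifting_pair_map:
  "lower_lifting (pair_poset L G) (pair_poset K H) (map_option (pair_map f))"
proof -
  let ?P = "pair_poset L G" and ?Q = "pair_poset K H" and ?F = "map_option (pair_map f)"
  have c: "fst p \<in> carrier L \<and> snd p \<subseteq> carrier L" if "ple L p (\<bottom>\<^bsub>L\<^esub>, G)" for p
    using L.pair_valid[OF that] by (auto simp: L.valid_def)
  have into: "ple K (pair_map f p) (\<bottom>\<^bsub>K\<^esub>, H)" if "ple L p (\<bottom>\<^bsub>L\<^esub>, G)" for p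
    using pair_map_mono[OF that] by (simp add: L.G_closed pair_map_top)
  have lift: "\<exists>p. ple L p (\<bottom>\<^bsub>L\<^esub>, G) \<and> ple L p q \<and> pair_map f p = s"
    if q: "ple L q (\<bottom>\<^bsub>L\<^esub>, G)" and s: "ple K s (pair_map f q)" for q s
  proof -
    obtain p where p: "ple L p q" "pair_map f p = s" using pair_map_lift c[OF q] s by blast
    moreover have "ple L p (\<bottom>\<^bsub>L\<^esub>, G)" using L.ple_trans[OF p(1) q] by (simp add: L.G_closed)
    ultimately show ?thesis by blast
  qed
  show ?thesis
    unfolding lower_lifting_def
  proof (intro conjI ballI impI)
    show "?F ` carrier ?P = carrier ?Q"
    proof (intro equalityI subsetI)
      fix t assume "t \<in> ?F ` carrier ?P"
      then show "t \<in> carrier ?Q" using into by (auto simp: pair_poset_def simp del: split_paired_All)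
    next
      fix t assume t: "t \<in> carrier ?Q"
      show "t \<in> ?F ` carrier ?P"
      proof (cases t)
        case None
        then show ?thesis by (auto simp: pair_poset_def)
      next
        case (Some s)
        \<comment> \<open>Every pair of the target lies below the image of the top pair, so
          surjectivity is an instance of lifting.\<close>
        then have "ple K s (pair_map f (\<bottom>\<^bsub>L\<^esub>, G))" using t by (simp add: pair_map_top)
        then obtain p where "ple L p (\<bottom>\<^bsub>L\<^esub>, G)" "pair_map f p = s"
          using lift[of "(\<bottom>\<^bsub>L\<^esub>, G)"] L.ple_refl[OF L.valid_top] by blast
        then have "Some p \<in> carrier ?P" "?F (Some p) = t" using Some by auto
        then show ?thesis by blast
      qed
    qed
  next
    fix p q assume "p \<in> carrier ?P" "q \<in> carrier ?P" "p \<sqsubseteq>\<^bsub>?P\<^esub> q"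
    then show "?F p \<sqsubseteq>\<^bsub>?Q\<^esub> ?F q"
      using c pair_map_mono by (cases p; cases q) (simp_all del: split_paired_All)
  next
    fix q s assume a: "q \<in> carrier ?P" "s \<in> carrier ?Q" "s \<sqsubseteq>\<^bsub>?Q\<^esub> ?F q"
    show "\<exists>p\<in>carrier ?P. p \<sqsubseteq>\<^bsub>?P\<^esub> q \<and> ?F p = s"
    proof (cases s)
      case None
      then show ?thesis by (intro bexI[of _ None]) auto
    next
      case (Some s')
      then obtain q' where q': "q = Some q'" using a by (cases q) auto
      then have "ple L q' (\<bottom>\<^bsub>L\<^esub>, G)" "ple K s' (pair_map f q')" using a Some by auto
      then obtain p where "ple L p (\<bottom>\<^bsub>L\<^esub>, G)" "ple L p q'" "pair_map f p = s'" using lift by blast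
      then have "Some p \<in> carrier ?P" "Some p \<sqsubseteq>\<^bsub>?P\<^esub> q" "?F (Some p) = s"
        using Some q' by auto
      then show ?thesis by blast
    qed
  qed
qed

lemma pair_posets_isomorphic:
  assumes "inj_on f (carrier L)"
  shows "poset_isomorphic (pair_poset L G) (pair_poset K H)"
proof (rule lower_lifting_inj_iso[OF L.partial_order_pair_poset K.partial_order_pair_poset lower_lifting_pair_map])
  have "p = q" if pq: "ple L p (\<bottom>\<^bsub>L\<^esub>, G)" "ple L q (\<bottom>\<^bsub>L\<^esub>, G)" "pair_map f p = pair_map f q" for p q
  proof -
    have c: "fst p \<in> carrier L" "snd p \<subseteq> carrier L" "fst p \<notin> snd p"
      "fst q \<in> carrier L" "snd q \<subseteq> carrier L" "fst q \<notin> snd q"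
      using L.pair_valid[OF pq(1)] L.pair_valid[OF pq(2)] by (auto simp: L.valid_def L.lless_iff)
    have "f (fst p) \<notin> f ` snd p" "f (fst q) \<notin> f ` snd q"
      using c assms by (auto simp: inj_on_def)
    then have "f (fst p) = f (fst q)" "f ` snd p = f ` snd q"
      using pq(3) by (auto simp: pair_map_def)
    then show ?thesis
      using c assms by (metis inj_onD inj_on_image_eq_iff prod_eqI)
  qed
  then have "s = t" if "s \<in> carrier (pair_poset L G)" "t \<in> carrier (pair_poset L G)"
    "map_option (pair_map f) s = map_option (pair_map f) t" for s t
    using that by (cases s; cases t) (simp_all del: split_paired_All)
  then show "inj_on (map_option (pair_map f)) (carrier (pair_poset L G))"
    by (rule inj_onI)
qed

text \<open>Let \<open>c\<close> be strictly above a maximal \<open>a\<close>. Then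
  \<open>f (c \<squnion> b) = f (c \<squnion> a) = f c\<close>; if \<open>c\<close> were not above
  \<open>b\<close>, it would lie strictly below \<open>c \<squnion> b\<close> and be a larger
  candidate than \<open>a\<close>.\<close>

lemma not_inj_cover:
  assumes "\<not> inj_on f (carrier L)"
  obtains a b where "a \<in> carrier L" "b \<in> carrier L" "a \<sqsubset>\<^bsub>L\<^esub> b" "f a = f b"
    "\<And>c. \<lbrakk>c \<in> carrier L; a \<sqsubset>\<^bsub>L\<^esub> c\<rbrakk> \<Longrightarrow> b \<sqsubseteq>\<^bsub>L\<^esub> c"
proof -
  define T where "T = {a \<in> carrier L. \<exists>b\<in>carrier L. a \<sqsubset>\<^bsub>L\<^esub> b \<and> f a = f b}"
  have "T \<noteq> {}"
  proof -
    obtain x y where xy: "x \<in> carrier L" "y \<in> carrier L" "f x = f y" "x \<noteq> y"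
      using assms by (auto simp: inj_on_def)
    \<comment> \<open>The join makes the collision comparable: it has the same image, and at least
      one of \<open>x\<close>, \<open>y\<close> lies strictly below it.\<close>
    let ?j = "x \<squnion>\<^bsub>L\<^esub> y"
    have "f ?j = f x" using xy f_join f_closed by (simp add: K.join_absorb)
    moreover have j: "x \<sqsubseteq>\<^bsub>L\<^esub> ?j" "y \<sqsubseteq>\<^bsub>L\<^esub> ?j" "?j \<in> carrier L"
      using xy L.join_left L.join_right by auto
    moreover have "x \<noteq> ?j \<or> y \<noteq> ?j" using xy(4) by metis
    ultimately have "x \<in> T \<or> y \<in> T" using xy(1-3) j
      by (auto simp: T_def L.lless_iff intro!: bexI[of _ ?j])
    then show ?thesis by blast
  qed
  then obtain a where a: "a \<in> T" "\<And>s. s \<in> T \<Longrightarrow> a \<sqsubseteq>\<^bsub>L\<^esub> s \<Longrightarrow> s = a"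
    using L.finite_has_maximal[of T] L.finite_carrier unfolding T_def by blast
  then obtain b where b: "a \<in> carrier L" "b \<in> carrier L" "a \<sqsubset>\<^bsub>L\<^esub> b" "f a = f b"
    unfolding T_def by blast
  have "b \<sqsubseteq>\<^bsub>L\<^esub> c" if c: "c \<in> carrier L" "a \<sqsubset>\<^bsub>L\<^esub> c" for c
  proof (rule ccontr)
    assume n: "\<not> b \<sqsubseteq>\<^bsub>L\<^esub> c"
    have "f (c \<squnion>\<^bsub>L\<^esub> b) = f (c \<squnion>\<^bsub>L\<^esub> a)" using b c f_join by simp
    also have "c \<squnion>\<^bsub>L\<^esub> a = c" using b c by (simp add: L.join_absorb L.lless_iff)
    finally have "f c = f (c \<squnion>\<^bsub>L\<^esub> b)" by simp
    moreover have "c \<sqsubset>\<^bsub>L\<^esub> c \<squnion>\<^bsub>L\<^esub> b"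
      using b c n L.join_left[of c b] L.join_right[of c b] by (auto simp: L.lless_iff)
    ultimately have "c \<in> T" using b c unfolding T_def by auto
    then show False using a(2) c by (auto simp: L.lless_iff)
  qed
  then show ?thesis using that b by blast
qed

end

section \<open>Removing an element with a unique cover\<close>

text \<open>The unique cover makes \<open>a\<close> meet irreducible, so deleting \<open>a\<close>
  keeps the meets of the other elements; a join equal to \<open>a\<close> moves up to
  \<open>b\<close>.\<close>

locale unique_cover = gen_enriched_lattice L G for L :: "'a gorder" (structure) and G +
  fixes a b :: 'a
  assumes ab: "a \<in> carrier L" "b \<in> carrier L" "a \<sqsubset> b"
    and above: "\<And>c. \<lbrakk>c \<in> carrier L; a \<sqsubset> c\<rbrakk> \<Longrightarrow> b \<sqsubseteq> c"
begin

definition r :: "'a \<Rightarrow> 'a" where "r x = (if x = a then b else x)"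

definition L' :: "'a gorder" where "L' = L\<lparr>carrier := carrier L - {a}\<rparr>"

definition G' :: "'a set" where "G' = r ` G - {r \<bottom>}"

lemma a_b: "a \<sqsubseteq> b" "a \<noteq> b" "\<not> b \<sqsubseteq> a"
  using ab le_antisym by (auto simp: lless_iff)

lemma r_simps [simp]: "r a = b" "r b = b" "x \<noteq> a \<Longrightarrow> r x = x" "r x \<noteq> a"
  using a_b by (auto simp: r_def)

lemma carrier_L' [simp]: "x \<in> carrier L' \<longleftrightarrow> x \<in> carrier L \<and> x \<noteq> a"
  by (simp add: L'_def)

lemma le_L' [simp]: "x \<sqsubseteq>\<^bsub>L'\<^esub> y \<longleftrightarrow> x \<sqsubseteq> y"
  by (simp add: L'_def)

lemma r_closed [simp]: "x \<in> carrier L \<Longrightarrow> r x \<in> carrier L"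
  using ab by (simp add: r_def)

text \<open>The map \<open>r\<close> is left adjoint to the inclusion of \<open>L'\<close> in
  \<open>L\<close>. Its preservation of joins and of the bottom rests on this.\<close>

lemma r_le_iff: "\<lbrakk>x \<in> carrier L; u \<in> carrier L; u \<noteq> a\<rbrakk> \<Longrightarrow> r x \<sqsubseteq> u \<longleftrightarrow> x \<sqsubseteq> u"
  using ab above[of u] le_trans[of a b u] by (auto simp: r_def lless_iff)

lemma partial_order_L': "partial_order L'"
proof -
  have "eq L' = (=)" by (simp add: L'_def eq_is_equal)
  moreover have "carrier L' \<subseteq> carrier L" by auto
  ultimately show ?thesis
    by unfold_locales (auto intro: le_antisym, meson le_trans subsetD)
qed

lemma lub_L':
  assumes "x \<in> carrier L" "y \<in> carrier L"
  shows "least L' (r (x \<squnion> y)) (Upper L' {r x, r y})"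
proof (rule least_UpperI)
  have rle: "u \<sqsubseteq> r u" if "u \<in> carrier L" for u
    using that a_b by (simp add: r_def)
  fix u assume "u \<in> {r x, r y}"
  then show "u \<sqsubseteq>\<^bsub>L'\<^esub> r (x \<squnion> y)"
    using assms rle[of "x \<squnion> y"] join_left[of x y] join_right[of x y]
    by (auto simp: r_le_iff intro: le_trans)
next
  fix u assume "u \<in> Upper L' {r x, r y}"
  then show "r (x \<squnion> y) \<sqsubseteq>\<^bsub>L'\<^esub> u"
    using assms by (auto simp: Upper_def r_le_iff)
qed (use assms in auto)

text \<open>If two elements other than \<open>a\<close> had meet \<open>a\<close>, both would lie
  above \<open>b\<close>, and so would their meet.\<close>

lemma glb_L':
  assumes "x \<in> carrier L'" "y \<in> carrier L'"
  shows "greatest L' (x \<sqinter> y) (Lower L' {x, y})"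
proof (rule greatest_LowerI)
  have c: "x \<in> carrier L" "y \<in> carrier L" "x \<noteq> a" "y \<noteq> a" using assms by auto
  have "x \<sqinter> y \<noteq> a"
  proof
    assume m: "x \<sqinter> y = a"
    have "b \<sqsubseteq> x" "b \<sqsubseteq> y" using c above m meet_left[OF c(1,2)] meet_right[OF c(1,2)]
      by (auto simp: lless_iff)
    then have "b \<sqsubseteq> a" using meet_le[of b x y] c ab m by simp
    then show False using a_b by simp
  qed
  then show "x \<sqinter> y \<in> carrier L'" using c by simp
  show "x \<sqinter> y \<sqsubseteq>\<^bsub>L'\<^esub> u" if "u \<in> {x, y}" for u
    using that meet_left[OF c(1,2)] meet_right[OF c(1,2)] by auto
  show "u \<sqsubseteq>\<^bsub>L'\<^esub> x \<sqinter> y" if "u \<in> Lower L' {x, y}" for u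
    using that c by (auto simp: Lower_def intro: meet_le)
qed (use assms in auto)

lemma finite_lattice_L': "finite_lattice L'"
proof -
  interpret L': partial_order L' by (rule partial_order_L')
  show ?thesis
  proof unfold_locales
    show "\<exists>s. least L' s (Upper L' {x, y})" if "x \<in> carrier L'" "y \<in> carrier L'" for x y
      using lub_L'[of x y] that by auto
    show "\<exists>s. greatest L' s (Lower L' {x, y})" if "x \<in> carrier L'" "y \<in> carrier L'" for x y
      using glb_L'[OF that] by blast
    show "finite (carrier L')" using finite_carrier by (simp add: L'_def)
    have "b \<in> carrier L'" using ab a_b by simp
    then show "carrier L' \<noteq> {}" by blast
  qed
qed

sublocale L': finite_lattice L'
  by (rule finite_lattice_L')

lemma join_L': "\<lbrakk>x \<in> carrier L; y \<in> carrier L\<rbrakk> \<Longrightarrow> r (x \<squnion> y) = r x \<squnion>\<^bsub>L'\<^esub> r y"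
  using L'.sup_eqI[OF lub_L'] by (simp add: join_def[of L'])

lemma bottom_L': "\<bottom>\<^bsub>L'\<^esub> = r \<bottom>"
  by (rule L'.bottom_eqI) (auto simp: r_le_iff)

lemma gen_L': "gen_enriched_lattice L' G'"
proof (rule gen_enriched_latticeI[OF finite_lattice_L'])
  show "G' \<subseteq> carrier L' - {\<bottom>\<^bsub>L'\<^esub>}"
    using G_closed by (auto simp: G'_def bottom_L')
  show "carrier L' \<subseteq> jspan L' \<bottom>\<^bsub>L'\<^esub> G'"
  proof
    fix x assume x: "x \<in> carrier L'"
    have "r u \<in> jspan L' (r \<bottom>) G'" if "u \<in> jspan L \<bottom> G" for u
      using that
    proof induction
      case base
      then show ?case by (rule jspan.base)
    next
      case (step u h)
      have c: "u \<in> carrier L" "h \<in> carrier L"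
        using step jspan_bottom G_closed by auto
      show ?case
      proof (cases "r h = r \<bottom>")
        case True
        have "r u \<squnion>\<^bsub>L'\<^esub> r h = r u"
        proof (rule L'.join_absorb)
          show "r u \<in> carrier L'" "r h \<in> carrier L'" using c by auto
          then show "r h \<sqsubseteq>\<^bsub>L'\<^esub> r u" using L'.bottom_lower'[of "r u"] True bottom_L' by simp
        qed
        then show ?thesis using step c join_L' by simp
      next
        case False
        then have "r h \<in> G'" using step by (auto simp: G'_def)
        then show ?thesis using step c join_L' jspan.step by metis
      qed
    qed
    then show "x \<in> jspan L' \<bottom>\<^bsub>L'\<^esub> G'"
      using x jspan_bottom bottom_L' r_simps(3) carrier_L' by metis
  qed
qed

lemma strong_surjection_r: "strong_surjection L G L' G' r"
proof -
  have "lattice L" "lattice L'" by unfold_locales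
  then have "join_pres L L' r" by (simp add: join_pres_def join_L')
  then show ?thesis
    by (auto simp: strong_surjection_def strong_map_def bottom_L' G'_def)
qed

sublocale strong_surj L G L' G' r
  by (intro strong_surj.intro strong_surj_axioms.intro gen_L' gen_enriched_lattice_axioms strong_surjection_r)

text \<open>Composing \<open>f\<close> with \<open>r\<close> changes nothing when
  \<open>f a = f b\<close>, so \<open>f\<close> itself serves as the second factor.\<close>

lemma strong_surjection_factor:
  assumes f: "strong_surjection L G K H f" and K: "gen_enriched_lattice K H" and fab: "f a = f b"
  shows "strong_surjection L' G' K H f"
proof -
  interpret M: gen_enriched_lattice K H by fact
  have fr: "f (r x) = f x" for x using fab by (simp add: r_def)
  have f': "f \<in> carrier L \<rightarrow> carrier K" "join_pres L K f" "f \<bottom> = \<bottom>\<^bsub>K\<^esub>" "f ` (G \<union> {\<bottom>}) = H \<union> {\<bottom>\<^bsub>K\<^esub>}"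
    using f by (auto simp: strong_surjection_def strong_map_def)
  have "f (x \<squnion>\<^bsub>L'\<^esub> y) = f x \<squnion>\<^bsub>K\<^esub> f y" if "x \<in> carrier L'" "y \<in> carrier L'" for x y
  proof -
    have "x \<squnion>\<^bsub>L'\<^esub> y = r (x \<squnion> y)" using join_L'[of x y] that by simp
    then show ?thesis using f'(2) that by (simp add: fr join_pres_def)
  qed
  moreover have "lattice L'" "lattice K" by unfold_locales
  ultimately have "join_pres L' K f" by (auto simp: join_pres_def)
  moreover have "f ` (G' \<union> {r \<bottom>}) = f ` (G \<union> {\<bottom>})"
  proof -
    have "G' \<union> {r \<bottom>} = r ` (G \<union> {\<bottom>})" by (auto simp: G'_def)
    then show ?thesis by (simp add: image_image fr del: image_insert)
  qed
  ultimately show ?thesis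
    using f' by (auto simp: strong_surjection_def strong_map_def bottom_L' fr)
qed

text \<open>The join with \<open>a\<close> lies strictly above \<open>a\<close>, hence above
  \<open>b\<close>. Contracting to \<open>a\<close> and to \<open>b\<close> can thus differ only on
  elements below \<open>a\<close>.\<close>

lemma join_cover:
  assumes g: "g \<in> carrier L" "\<not> g \<sqsubseteq> a"
  shows "g \<squnion> a = g \<squnion> b"
proof -
  have "g \<squnion> a \<noteq> a" using join_left[of g a] g ab by metis
  then have "b \<sqsubseteq> g \<squnion> a"
    using g ab above[of "g \<squnion> a"] join_right[of g a] by (auto simp: lless_iff)
  then show ?thesis
    using g ab a_b by (intro le_antisym) (auto intro: join_left join_right le_trans)
qed

lemma notin_contracted:
  assumes "A \<subseteq> contracted z" "z \<in> carrier L" "h \<in> A"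
  shows "\<not> h \<sqsubseteq> z"
proof -
  have "valid (z, A)" using assms pair_valid by (simp add: ple_top)
  then have "z \<sqsubseteq> h" "z \<noteq> h" "h \<in> carrier L" using assms(3) by (auto simp: valid_def lless_iff)
  then show ?thesis using assms(2) le_antisym by blast
qed

text \<open>As \<open>b\<close> is not below \<open>a\<close> while \<open>z\<close> is, some
  generator \<open>g\<close> below \<open>b\<close> is not below \<open>a\<close>, and
  \<open>join_cover\<close> gives \<open>g \<squnion> a = g \<squnion> b = b\<close>. So a span
  reaching \<open>b\<close> from below \<open>a\<close> has \<open>b\<close> as a generator after
  contraction to \<open>a\<close>.\<close>

lemma cover_obtain_gen:
  assumes z: "z \<in> carrier L" "z \<sqsubseteq> a" and A: "A \<subseteq> carrier L" and b: "b \<in> jspan L z A"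
  obtains g where "g \<in> A" "g \<squnion> a = b"
proof -
  have "\<exists>g\<in>A. \<not> g \<sqsubseteq> a \<and> g \<sqsubseteq> u" if "u \<in> jspan L z A" "\<not> u \<sqsubseteq> a" for u
    using that
  proof induction
    case base
    then show ?case using z by simp
  next
    case (step u h)
    have c: "u \<in> carrier L" "h \<in> carrier L" using jspan_closed[OF z(1) A step(1)] step(2) A by auto
    show ?case
    proof (cases "u \<sqsubseteq> a")
      case True
      then have "\<not> h \<sqsubseteq> a" using step c ab by simp
      then show ?thesis using step(2) c join_right by blast
    next
      case False
      then obtain g where g: "g \<in> A" "\<not> g \<sqsubseteq> a" "g \<sqsubseteq> u" using step(3) by blast
      then have "g \<sqsubseteq> u \<squnion> h" using c A join_left[OF c] le_trans[of g u "u \<squnion> h"] by auto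
      then show ?thesis using g by blast
    qed
  qed
  then obtain g where g: "g \<in> A" "\<not> g \<sqsubseteq> a" "g \<sqsubseteq> b" using b a_b by blast
  then have "g \<squnion> a = b" using join_cover[of g] A ab join_absorb'[of g b] by auto
  then show ?thesis using that g by blast
qed

text \<open>Generators not below \<open>a\<close> have the same joins with \<open>a\<close> and
  \<open>b\<close>; those below \<open>a\<close> collapse on both sides. The extra \<open>b\<close>
  is the minimum removed from \<open>contracted b\<close>, but a genuine generator over
  \<open>a\<close>.\<close>

lemma contracted_a: "contracted a = insert b (contracted b)"
proof -
  obtain g where g: "g \<in> G" "g \<squnion> a = b"
    using cover_obtain_gen[of \<bottom> G] G_closed jspan_bottom ab by auto
  have 1: "g \<squnion> a = g \<squnion> b" if "g \<in> G" "\<not> g \<sqsubseteq> a" for g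
    using that join_cover G_closed by blast
  have 2: "g \<squnion> a = a \<and> g \<squnion> b = b" if "g \<in> G" "g \<sqsubseteq> a" for g
  proof -
    have "g \<in> carrier L" using that G_closed by blast
    then show ?thesis using that ab a_b le_trans[of g a b] by (simp add: join_absorb')
  qed
  have 3: "\<not> g \<sqsubseteq> a \<Longrightarrow> g \<squnion> a \<noteq> a" if "g \<in> G" for g
    using that ab join_left[of g a] G_closed by auto
  show ?thesis
  proof (intro equalityI subsetI)
    fix h assume "h \<in> contracted a"
    then obtain k where "k \<in> G" "h = k \<squnion> a" "h \<noteq> a" by (auto simp: contracted_def)
    then show "h \<in> insert b (contracted b)" using 1[of k] 2[of k] by (auto simp: contracted_def)
  next
    fix h assume "h \<in> insert b (contracted b)"
    then consider "h = b" | k where "k \<in> G" "h = k \<squnion> b" "h \<noteq> b" by (auto simp: contracted_def)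
    then show "h \<in> contracted a"
    proof cases
      case 1
      then show ?thesis using g a_b unfolding contracted_def by blast
    next
      case k: 2
      then have "\<not> k \<sqsubseteq> a" using 2 by auto
      then have "h = k \<squnion> a" "h \<noteq> a" using k 1[of k] 3[of k] by auto
      then show ?thesis using k(1) unfolding contracted_def by blast
    qed
  qed
qed

section \<open>The fibres of the elementary surjection on pairs\<close>

definition is_minor :: "'a \<Rightarrow> 'a set \<Rightarrow> bool" where
  "is_minor z A \<longleftrightarrow> z \<in> carrier L \<and> A \<subseteq> contracted z"

lemma fibre_iff:
  "t \<in> fibre (pair_poset L G) (map_option (pair_map r)) (Some (s, B)) \<longleftrightarrow>
    (\<exists>z A. t = Some (z, A) \<and> is_minor z A \<and> r z = s \<and> r ` A - {s} = B)"
  by (cases t) (auto simp: fibre_def ple_top is_minor_def pair_map_def)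

lemma is_minor_valid: "is_minor z A \<Longrightarrow> valid (z, A)"
  using pair_valid by (simp add: ple_top is_minor_def)

lemma is_minor_above: "\<lbrakk>is_minor z A; h \<in> A\<rbrakk> \<Longrightarrow> \<not> h \<sqsubseteq> z"
  using notin_contracted by (auto simp: is_minor_def)

text \<open>The fibre over \<open>(b, B)\<close> is \<open>{(a, B), (b, B), (a, B \<union> {b})}\<close>.\<close>

lemma zippable_fibre_b:
  assumes ne: "is_minor z A" "r z = b" "r ` A - {b} = B"
  shows "zippable (pair_poset L G) (fibre (pair_poset L G) (map_option (pair_map r)) (Some (b, B)))"
proof -
  have nab: "a \<notin> D \<and> (z = b \<longrightarrow> b \<notin> D)" if "is_minor z D" "z = a \<or> z = b" for z D
    using that is_minor_above[of z D a] is_minor_above[of z D b] ab a_b by auto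
  have z: "z = a \<or> z = b" if "r z = b" for z using that by (auto simp: r_def split: if_splits)
  have rD: "r ` D = D" if "a \<notin> D" for D using that by (force simp: r_def)
  have b_notin: "b \<notin> contracted b" by (simp add: contracted_def)
  have B: "B \<subseteq> contracted b" "a \<notin> B" "b \<notin> B"
  proof -
    have "a \<notin> A" using nab[OF ne(1) z[OF ne(2)]] by simp
    then have "B = A - {b}" using rD[of A] ne(3) by simp
    then show "B \<subseteq> contracted b" "a \<notin> B" "b \<notin> B"
      using ne(1) z[OF ne(2)] \<open>a \<notin> A\<close> contracted_a by (auto simp: is_minor_def)
  qed
  have m: "is_minor a B" "is_minor b B" "is_minor a (insert b B)"
    using B ab by (auto simp: is_minor_def contracted_a)
  have "fibre (pair_poset L G) (map_option (pair_map r)) (Some (b, B)) =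
      {Some (a, B), Some (b, B), Some (a, insert b B)}" (is "?f = ?S")
  proof (intro equalityI subsetI)
    fix t assume "t \<in> ?f"
    then obtain y D where D: "t = Some (y, D)" "is_minor y D" "r y = b" "r ` D - {b} = B"
      unfolding fibre_iff by blast
    have "a \<notin> D" "y = b \<Longrightarrow> b \<notin> D" using nab[OF D(2) z[OF D(3)]] by auto
    then show "t \<in> ?S" using D z[OF D(3)] rD[of D] by (cases "b \<in> D") auto
  next
    fix t assume "t \<in> ?S"
    then show "t \<in> ?f" unfolding fibre_iff using m B rD[of B] by auto
  qed
  moreover have "ple L (a, B) (a, insert b B)" "\<not> ple L (a, B) (b, B)"
  proof -
    show "ple L (a, B) (a, insert b B)" using ple_subset is_minor_valid m by blast
    show "\<not> ple L (a, B) (b, B)"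
      using jspan_closed[OF ab(2), of B a] is_minor_valid[OF m(2)] a_b by (auto simp: ple_def valid_def)
  qed
  \<comment> \<open>Contract by the generator \<open>b\<close>: the minimum becomes \<open>b\<close>
    and the generators in \<open>B\<close> stay as they are.\<close>
  moreover have "ple L (b, B) (a, insert b B)"
  proof -
    have "b \<in> jspan L a (insert b B)"
      using jspan.step[OF jspan.base, of b "insert b B" L a] ab a_b by (simp add: join_absorb')
    moreover have "h \<squnion> b = h \<and> h \<noteq> b" if "h \<in> B" for h
      using that is_minor_valid[OF m(2)] ab by (auto simp: valid_def lless_iff intro!: join_absorb)
    then have "B \<subseteq> (\<lambda>h. h \<squnion> b) ` insert b B - {b}" by (auto simp: image_iff)
    ultimately show ?thesis by (simp add: ple_def)
  qed
  \<comment> \<open>To reach \<open>b\<close> from \<open>a\<close> within \<open>B\<close>, a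
    generator \<open>g\<close> with \<open>g \<squnion> a = b\<close> is needed; it lies above
    \<open>a\<close>, so it would be \<open>b\<close> itself, which is not in
    \<open>B\<close>.\<close>
  moreover have "\<not> ple L (b, B) (a, B)"
  proof
    assume "ple L (b, B) (a, B)"
    then have "b \<in> jspan L a B" by (simp add: ple_def)
    then obtain g where g: "g \<in> B" "g \<squnion> a = b"
      using cover_obtain_gen[of a B] ab is_minor_valid[OF m(1)] by (auto simp: valid_def)
    then have "g \<squnion> a = g" using is_minor_valid[OF m(1)] ab
      by (intro join_absorb) (auto simp: valid_def lless_iff)
    then show False using g B by simp
  qed
  \<comment> \<open>The span of \<open>q\<close> contains \<open>a\<close> and \<open>b\<close>, so
    some generator of \<open>q\<close> joins with \<open>a\<close> to \<open>b\<close>; hence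
    \<open>b\<close> is available once \<open>q\<close> is contracted to \<open>a\<close>.\<close>
  moreover have "ple L (a, insert b B) q"
    if q: "ple L q (\<bottom>, G)" "ple L (a, B) q" "ple L (b, B) q" for q
  proof -
    have v: "fst q \<in> carrier L" "snd q \<subseteq> carrier L" using pair_valid[OF q(1)] by (auto simp: valid_def)
    have "a \<in> jspan L (fst q) (snd q)" "b \<in> jspan L (fst q) (snd q)" using q by (auto simp: ple_def)
    then obtain g where "g \<in> snd q" "g \<squnion> a = b"
      using cover_obtain_gen[of "fst q" "snd q"] v jspan_closed[OF v] by metis
    then show ?thesis using q(2) a_b unfolding ple_def by auto
  qed
  ultimately show ?thesis
    unfolding zippable_def
    by (intro exI[of _ "Some (a, B)"] exI[of _ "Some (b, B)"] exI[of _ "Some (a, insert b B)"])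
      (auto simp: pair_poset_def simp del: split_paired_All)
qed

text \<open>For \<open>s \<noteq> b\<close> the fibre over \<open>(s, B)\<close> consists of all \<open>(s, A)\<close> such that \<open>A\<close> becomes \<open>B\<close> on
  replacing \<open>a\<close> by \<open>b\<close>; it has three elements if \<open>b \<in> B\<close> and both \<open>a\<close> and \<open>b\<close> are generators of
  the contraction to \<open>s\<close>, and one otherwise.\<close>

lemma fibre_not_b:
  assumes ne: "is_minor s A" "s \<noteq> a" "s \<noteq> b" "r ` A = B"
  defines "\<F> \<equiv> fibre (pair_poset L G) (map_option (pair_map r)) (Some (s, B))"
  shows "is_singleton \<F> \<or> zippable (pair_poset L G) \<F>"
proof -
  have s: "s \<in> carrier L" using ne by (simp add: is_minor_def)
  have rs: "r z = s \<longleftrightarrow> z = s" for z using ne by (auto simp: r_def)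
  have notin: "s \<notin> r ` D" if "is_minor s D" for D
    using that is_minor_above[OF that] s ne by (auto simp: r_def)
  have F: "t \<in> \<F> \<longleftrightarrow> (\<exists>D. t = Some (s, D) \<and> D \<subseteq> contracted s \<and> r ` D = B)" for t
    unfolding \<F>_def fibre_iff rs using notin s by (auto simp: is_minor_def)
  define B0 where "B0 = B - {b}"
  have aB: "a \<notin> B" using ne(4) r_simps(4) by (metis imageE)
  have rD: "r ` D = (if a \<in> D then insert b (D - {a}) else D)" for D
    by (auto simp: r_def image_iff)
  have AB: "A \<subseteq> contracted s" using ne by (simp add: is_minor_def)
  have B0: "B0 \<subseteq> contracted s" using AB ne(4) rD[of A] by (auto simp: B0_def split: if_splits)
  \<comment> \<open>A preimage of \<open>B\<close> without \<open>a\<close> is \<open>B\<close>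
    itself; one with \<open>a\<close> may or may not also contain \<open>b\<close>.\<close>
  have cases: "D = B \<or> b \<in> B \<and> (D = insert a B0 \<or> D = insert a B)" if D: "r ` D = B" for D
  proof (cases "a \<in> D")
    case True
    then have "B = insert b (D - {a})" "D = insert a (D - {a})" using D rD[of D] by auto
    then show ?thesis unfolding B0_def by (cases "b \<in> D") (blast, metis Diff_insert_absorb DiffD1 insertI1)
  next
    case False
    then show ?thesis using D rD[of D] by simp
  qed
  show ?thesis
  proof (cases "b \<in> B \<and> a \<in> contracted s \<and> b \<in> contracted s")
    case True
    then have BB: "B = insert b B0" "B \<subseteq> contracted s" using B0 by (auto simp: B0_def)
    have m: "is_minor s B" "is_minor s (insert a B0)" "is_minor s (insert a B)"
      using True B0 BB s by (auto simp: is_minor_def)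
    have "\<F> = {Some (s, B), Some (s, insert a B0), Some (s, insert a B)}" (is "_ = ?S")
    proof (intro equalityI subsetI)
      fix t assume "t \<in> \<F>"
      then show "t \<in> ?S" unfolding F using cases by blast
    next
      fix t assume "t \<in> ?S"
      moreover have "insert a B0 - {a} = B0" "insert a B - {a} = B" using aB by (auto simp: B0_def)
      then have "r ` B = B" "r ` insert a B0 = B" "r ` insert a B = B"
        using aB BB(1) True rD[of B] rD[of "insert a B0"] rD[of "insert a B"] by (simp_all add: insert_absorb)
      ultimately show "t \<in> \<F>" unfolding F using m unfolding is_minor_def by blast
    qed
    moreover have "ple L (s, C) (s, D) \<longleftrightarrow> C \<subseteq> D" if "is_minor s C" "is_minor s D" for C D
      using ple_subset that is_minor_valid by blast
    then have "ple L (s, B) (s, insert a B)" "ple L (s, insert a B0) (s, insert a B)"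
      "\<not> ple L (s, B) (s, insert a B0)" "\<not> ple L (s, insert a B0) (s, B)"
      using m aB a_b True by (auto simp: B0_def)
    \<comment> \<open>Both hypotheses concern the same minimum \<open>s\<close>, so their generator
      conditions simply unite.\<close>
    moreover have "ple L (s, insert a B) q" if "ple L (s, B) q" "ple L (s, insert a B0) q" for q
      using that by (auto simp: ple_def)
    ultimately show ?thesis
      unfolding zippable_def
      by (intro disjI2 exI[of _ "Some (s, B)"] exI[of _ "Some (s, insert a B0)"] exI[of _ "Some (s, insert a B)"])
        (auto simp: pair_poset_def simp del: split_paired_All)
  next
    case False
    \<comment> \<open>If \<open>b\<close> is not in \<open>B\<close>, the preimage is
      \<open>B\<close>. If it is, the missing one of \<open>a\<close> and \<open>b\<close> in
      \<open>contracted s\<close> decides which of the two was the source.\<close>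
    have "D = A" if D: "D \<subseteq> contracted s" "r ` D = B" for D
      using cases[OF D(2)] cases[OF ne(4)] D(1) AB False aB by (auto simp: B0_def)
    then have "t \<in> \<F> \<longleftrightarrow> t = Some (s, A)" for t unfolding F using AB ne(4) by blast
    then have "\<F> = {Some (s, A)}" by blast
    then show ?thesis by simp
  qed
qed

lemma fibres:
  assumes t: "t \<in> carrier (pair_poset L' G')"
  defines "\<F> \<equiv> fibre (pair_poset L G) (map_option (pair_map r)) t"
  shows "is_singleton \<F> \<or> zippable (pair_poset L G) \<F>"
proof (cases t)
  case None
  then have "\<F> = {None}" by (auto simp: \<F>_def fibre_def)
  then show ?thesis by simp
next
  case (Some p)
  obtain s B where p: "p = (s, B)" by (cases p)
  \<comment> \<open>Surjectivity makes the fibre nonempty and supplies the representative from which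
    its shape is computed.\<close>
  have "t \<in> map_option (pair_map r) ` carrier (pair_poset L G)"
    using lower_lifting_pair_map t by (simp add: lower_lifting_def)
  then obtain x where "x \<in> carrier (pair_poset L G)" "t = map_option (pair_map r) x" by (rule imageE)
  then have "x \<in> fibre (pair_poset L G) (map_option (pair_map r)) (Some (s, B))"
    using Some p by (simp add: fibre_def)
  then obtain z A where A: "is_minor z A" "r z = s" "r ` A - {s} = B"
    unfolding fibre_iff by blast
  show ?thesis
  proof (cases "s = b")
    case True
    then show ?thesis using zippable_fibre_b A Some p by (simp add: \<F>_def)
  next
    case False
    then have z: "z = s" "z \<noteq> a" using A(2) by (auto simp: r_def split: if_splits)
    have "s \<notin> A" using A(1) z is_minor_above[of s A s] by (auto simp: is_minor_def)
    then have "r ` A = B" using A(3) False z by (auto simp: r_def)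
    then show ?thesis using fibre_not_b[of s A B] A(1) z False Some p by (simp add: \<F>_def)
  qed
qed

end

section \<open>Factoring a strong surjection\<close>

text \<open>After earlier zips the current poset is only known to be isomorphic to a
  \<open>pair_poset\<close>, so the elementary lifting and the shape of its fibres are transported
  to it.\<close>

lemma lower_lifting_iso:
  assumes M: "partial_order M" and iso: "poset_isomorphic M P"
    and F: "lower_lifting M Q F"
    and fibs: "\<And>s. s \<in> carrier Q \<Longrightarrow> is_singleton (fibre M F s) \<or> zippable M (fibre M F s)"
  shows "\<exists>F'. lower_lifting P Q F' \<and>
    (\<forall>s\<in>carrier Q. is_singleton (fibre P F' s) \<or> zippable P (fibre P F' s))"
proof -
  obtain g where g: "bij_betw g (carrier M) (carrier P)"
    "\<And>x y. x \<in> carrier M \<Longrightarrow> y \<in> carrier M \<Longrightarrow> g x \<sqsubseteq>\<^bsub>P\<^esub> g y \<longleftrightarrow> x \<sqsubseteq>\<^bsub>M\<^esub> y"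
    using iso by (rule poset_isomorphicE) blast
  define F' where "F' = F \<circ> inv_into (carrier M) g"
  have F'g: "F' (g x) = F x" if "x \<in> carrier M" for x
    using that g(1) by (simp add: F'_def bij_betw_inv_into_left)
  have P: "carrier P = g ` carrier M" using g(1) by (simp add: bij_betw_def)
  have "lower_lifting P Q F'"
    using F unfolding lower_lifting_def P by (simp add: image_image F'g g(2) ball_simps cong: image_cong_simp)
  moreover have "is_singleton (fibre P F' s) \<or> zippable P (fibre P F' s)" if s: "s \<in> carrier Q" for s
  proof -
    have fib: "fibre P F' s = g ` fibre M F s"
      unfolding fibre_def P using F'g by auto
    have "is_singleton (g ` A)" if "is_singleton A" for A
      using that by (auto elim!: is_singletonE)
    moreover have "zippable P (g ` fibre M F s)" if zp: "zippable M (fibre M F s)"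
    proof -
      obtain x y z where xyz: "fibre M F s = {x, y, z}" "x \<sqsubseteq>\<^bsub>M\<^esub> z" "y \<sqsubseteq>\<^bsub>M\<^esub> z" "\<not> x \<sqsubseteq>\<^bsub>M\<^esub> y" "\<not> y \<sqsubseteq>\<^bsub>M\<^esub> x"
        "\<And>u. \<lbrakk>u \<in> carrier M; x \<sqsubseteq>\<^bsub>M\<^esub> u; y \<sqsubseteq>\<^bsub>M\<^esub> u\<rbrakk> \<Longrightarrow> z \<sqsubseteq>\<^bsub>M\<^esub> u"
        using zippableE[OF zp] by metis
      have "x \<in> carrier M" "y \<in> carrier M" "z \<in> carrier M" using xyz(1) by (auto simp: fibre_def)
      then show ?thesis
        unfolding zippable_def xyz(1) P
        by (intro exI[of _ "g x"] exI[of _ "g y"] exI[of _ "g z"]) (simp add: g(2) xyz)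
    qed
    ultimately show ?thesis using fibs[OF s] fib by auto
  qed
  ultimately show ?thesis by blast
qed

text \<open>Each round splits off one elementary surjection: the lattice loses an element while
  \<open>f\<close> stays the same function. \<open>P\<close> is given up to isomorphism because
  zipping stays within the element type of the initial poset.\<close>

theorem zip_along_strong_surjection:
  fixes L :: "'a gorder" and K :: "'b gorder" and P :: "'e gorder"
  assumes "strong_surj L G K H f"
    and "partial_order P" "finite (carrier P)" "carrier P \<noteq> UNIV"
    and "poset_isomorphic P (pair_poset L G)"
  shows "\<exists>P'. (\<lambda>P P'. partial_order P' \<and> zip_step P P')\<^sup>*\<^sup>* P P' \<and> poset_isomorphic P' (pair_poset K H)"
  using assms
proof (induction "card (carrier L)" arbitrary: L G P rule: less_induct)
  case less
  interpret S: strong_surj L G K H f by fact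
  show ?case
  proof (cases "inj_on f (carrier L)")
    case True
    then show ?thesis
      using S.pair_posets_isomorphic poset_isomorphic_trans less.prems(5) by blast
  next
    case False
    then obtain a b where ab: "a \<in> carrier L" "b \<in> carrier L" "a \<sqsubset>\<^bsub>L\<^esub> b" "f a = f b"
      "\<And>c. \<lbrakk>c \<in> carrier L; a \<sqsubset>\<^bsub>L\<^esub> c\<rbrakk> \<Longrightarrow> b \<sqsubseteq>\<^bsub>L\<^esub> c"
      by (rule S.not_inj_cover) blast
    interpret U: unique_cover L G a b
      by unfold_locales (use ab in auto)
    obtain F where F: "lower_lifting P (pair_poset U.L' U.G') F"
      "\<And>s. s \<in> carrier (pair_poset U.L' U.G') \<Longrightarrow> is_singleton (fibre P F s) \<or> zippable P (fibre P F s)"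
      using lower_lifting_iso[OF S.L.partial_order_pair_poset poset_isomorphic_sym[OF less.prems(5)]
          U.lower_lifting_pair_map U.fibres] by blast
    obtain P1 where P1: "(\<lambda>P P'. partial_order P' \<and> zip_step P P')\<^sup>*\<^sup>* P P1" "partial_order P1"
      "finite (carrier P1)" "carrier P1 \<noteq> UNIV" "poset_isomorphic P1 (pair_poset U.L' U.G')"
      using zip_along_lower_lifting[OF less.prems(2-4) _ F] U.K.partial_order_pair_poset by blast
    have factor: "strong_surj U.L' U.G' K H f"
      using U.strong_surjection_factor[OF S.surj S.K.gen_enriched_lattice_axioms ab(4)]
      by (intro strong_surj.intro strong_surj_axioms.intro U.gen_L' S.K.gen_enriched_lattice_axioms)
    have smaller: "card (carrier U.L') < card (carrier L)"
      unfolding U.L'_def using ab(1) S.L.finite_carrier by (simp add: card_Diff1_less del: card_Diff_insert)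
    obtain P2 where P2: "(\<lambda>P P'. partial_order P' \<and> zip_step P P')\<^sup>*\<^sup>* P1 P2"
      "poset_isomorphic P2 (pair_poset K H)"
      using less.hyps[OF smaller factor P1(2-5)] by blast
    show ?thesis using rtranclp_trans[OF P1(1) P2(1)] P2(2) by blast
  qed
qed

section \<open>From minors to pairs\<close>

context finite_lattice
begin

definition minor :: "'a \<times> 'a set \<Rightarrow> 'a gorder \<times> 'a set" where
  "minor p = span_from L (snd p) (fst p)"

lemma minor_eq:
  assumes "valid p"
  shows "minor p = (L\<lparr>carrier := jspan L (fst p) (snd p)\<rparr>, snd p)"
  using assms by (simp add: minor_def span_from_def jspan_eq valid_def)

section \<open>Joins, deletions and contractions computed inside a minor\<close>

context
  fixes z A M
  assumes v: "valid (z, A)"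
  defines "M \<equiv> L\<lparr>carrier := jspan L z A\<rparr>"
begin

lemma zA: "z \<in> carrier L" "A \<subseteq> carrier L"
  using v by (auto simp: valid_def)

lemma carrier_M: "carrier M = jspan L z A" "carrier M \<subseteq> carrier L"
  using jspan_closed[OF zA] by (auto simp: M_def)

lemma le_M: "x \<sqsubseteq>\<^bsub>M\<^esub> y \<longleftrightarrow> x \<sqsubseteq> y"
  by (simp add: M_def)

lemma partial_order_M: "partial_order M"
proof -
  have "eq M = (=)" by (simp add: M_def eq_is_equal)
  moreover note carrier_M(2)
  ultimately show ?thesis
    by unfold_locales (auto simp: le_M intro: le_antisym, meson le_trans subsetD)
qed

lemma bottom_M: "\<bottom>\<^bsub>M\<^esub> = z"
  by (rule partial_order.bottom_eqI[OF partial_order_M])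
    (use jspan_closed[OF zA] in \<open>auto simp: carrier_M(1) le_M jspan.base\<close>)

lemma join_M:
  assumes xy: "x \<in> jspan L z A" "y \<in> jspan L z A"
  shows "x \<squnion>\<^bsub>M\<^esub> y = x \<squnion> y"
proof -
  have c: "x \<in> carrier L" "y \<in> carrier L" using xy jspan_closed[OF zA] by auto
  have "least M (x \<squnion> y) (Upper M {x, y})"
  proof (rule least_UpperI)
    show "u \<sqsubseteq>\<^bsub>M\<^esub> x \<squnion> y" if "u \<in> {x, y}" for u
      using that c join_left join_right by (auto simp: le_M)
    show "x \<squnion> y \<sqsubseteq>\<^bsub>M\<^esub> u" if "u \<in> Upper M {x, y}" for u
      using that c xy carrier_M by (auto simp: Upper_def le_M)
  qed (use xy jspan_join[OF zA] in \<open>auto simp: carrier_M(1)\<close>)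
  then show ?thesis
    using partial_order.sup_eqI[OF partial_order_M] by (simp add: join_def[of M])
qed

text \<open>The empty join is \<open>z\<close> in \<open>M\<close> but \<open>\<bottom>\<close> in
  \<open>L\<close>; joining with \<open>w\<close>, which lies above \<open>z\<close>, hides the
  difference.\<close>

lemma Sup_M:
  assumes X: "X \<subseteq> jspan L z A" and w: "w \<in> jspan L z A"
  shows "w \<squnion>\<^bsub>M\<^esub> \<Squnion>\<^bsub>M\<^esub>X = w \<squnion> \<Squnion>X"
proof (cases "X = {}")
  case True
  have "least M z (Upper M {})"
    using jspan_closed[OF zA] by (auto simp: least_def carrier_M(1) le_M jspan.base)
  then have "\<Squnion>\<^bsub>M\<^esub>X = z" using True partial_order.sup_eqI[OF partial_order_M] by blast
  then show ?thesis
    using True jspan_closed[OF zA w] zA by (simp add: join_M[OF w jspan.base] sup_empty join_absorb)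
next
  case False
  have c: "X \<subseteq> carrier L" using X jspan_closed[OF zA] by blast
  obtain x where x: "x \<in> X" using False by blast
  have up: "u \<sqsubseteq> \<Squnion>X" if "u \<in> X" for u using sup_le_iff[OF c, of "\<Squnion>X"] that c by auto
  have "z \<sqsubseteq> x" "x \<in> carrier L" using x X jspan_closed[OF zA] by auto
  then have "z \<sqsubseteq> \<Squnion>X" using up[OF x] c zA by (meson le_trans sup_closed')
  then have S: "\<Squnion>X \<in> jspan L z A"
    using jspan_Sup[OF zA X] c zA by (simp add: join_absorb')
  have "least M (\<Squnion>X) (Upper M X)"
  proof (rule least_UpperI)
    show "u \<sqsubseteq>\<^bsub>M\<^esub> \<Squnion>X" if "u \<in> X" for u using up that by (simp add: le_M)
    show "\<Squnion>X \<sqsubseteq>\<^bsub>M\<^esub> u" if u: "u \<in> Upper M X" for u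
    proof -
      have "u \<in> carrier L" "\<forall>x\<in>X. x \<sqsubseteq> u"
        using u X carrier_M by (auto simp: Upper_def le_M)
      then show ?thesis using sup_le_iff[OF c] by (simp add: le_M)
    qed
  qed (use S X in \<open>auto simp: carrier_M(1)\<close>)
  then have "\<Squnion>\<^bsub>M\<^esub>X = \<Squnion>X" by (rule partial_order.sup_eqI[OF partial_order_M])
  then show ?thesis using join_M[OF w S] by simp
qed

lemma span_from_M:
  assumes "B \<subseteq> jspan L z A" "w \<in> jspan L z A"
  shows "span_from M B w = minor (w, B)"
proof -
  have "{w \<squnion>\<^bsub>M\<^esub> \<Squnion>\<^bsub>M\<^esub>X | X. X \<subseteq> B} = {w \<squnion> \<Squnion>X | X. X \<subseteq> B}"
    using Sup_M[OF _ assms(2)] assms(1) by (metis (no_types, opaque_lifting) subset_trans)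
  then show ?thesis by (simp add: minor_def span_from_def M_def)
qed

lemma A_jspan: "A \<subseteq> jspan L z A"
proof
  fix h assume h: "h \<in> A"
  then have "z \<squnion> h = h" using v by (intro join_absorb') (auto simp: valid_def lless_iff)
  then show "h \<in> jspan L z A" using jspan.step[OF jspan.base[of z L A] h] by simp
qed

lemma deletion_M: "deletion M A I = minor (z, A - I)"
  unfolding deletion_def bottom_M using A_jspan by (intro span_from_M) (auto intro: jspan.base)

text \<open>The contracted element is a join in \<open>M\<close>, whose bottom is \<open>z\<close>;
  this accounts for the \<open>z\<close> in \<open>z \<squnion> \<Squnion>I\<close> and covers empty
  \<open>I\<close>.\<close>

lemma contraction_M:
  assumes "I \<subseteq> A"
  shows "contraction M A I = minor (z \<squnion> \<Squnion>I, (\<lambda>g. g \<squnion> (z \<squnion> \<Squnion>I)) ` A - {z \<squnion> \<Squnion>I})"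
proof -
  let ?i = "z \<squnion> \<Squnion>I"
  have I: "I \<subseteq> jspan L z A" using assms A_jspan by blast
  have i: "?i \<in> jspan L z A" by (rule jspan_Sup[OF zA I])
  have "\<Squnion>\<^bsub>M\<^esub>I = ?i"
  proof -
    have "least M ?i (Upper M I)"
    proof (rule least_UpperI)
      have c: "I \<subseteq> carrier L" using assms zA by blast
      have cS: "\<Squnion>I \<in> carrier L" using c by simp
      show "u \<sqsubseteq>\<^bsub>M\<^esub> ?i" if "u \<in> I" for u
        using that c cS zA sup_le_iff[OF c, of ?i] join_right[OF zA(1) cS] by (auto simp: le_M)
      show "?i \<sqsubseteq>\<^bsub>M\<^esub> u" if u: "u \<in> Upper M I" for u
      proof -
        have "u \<in> jspan L z A" "\<forall>x\<in>I. x \<sqsubseteq> u"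
          using u I by (auto simp: Upper_def le_M carrier_M(1))
        then show ?thesis
          using jspan_closed[OF zA, of u] sup_le_iff[OF c, of u] cS zA by (simp add: le_M)
      qed
    qed (use I i in \<open>auto simp: carrier_M(1)\<close>)
    then show ?thesis by (rule partial_order.sup_eqI[OF partial_order_M])
  qed
  moreover have "(\<lambda>g. g \<squnion>\<^bsub>M\<^esub> ?i) ` A = (\<lambda>g. g \<squnion> ?i) ` A"
    using join_M[OF _ i] A_jspan by (intro image_cong) auto
  moreover have "(\<lambda>g. g \<squnion> ?i) ` A - {?i} \<subseteq> jspan L z A"
    using jspan_join[OF zA _ i] A_jspan by auto
  ultimately show ?thesis
    unfolding contraction_def Let_def using span_from_M[OF _ i] by simp
qed

end

text \<open>Each deletion or contraction applies to a minor already described by a pair; it is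
  recomputed in \<open>L\<close>, and \<open>ple_trans\<close> keeps the result below
  \<open>q\<close>.\<close>

lemma minor_ofD:
  assumes "minor_of N (minor q)" "valid q"
  shows "\<exists>p. N = minor p \<and> ple L p q"
  using assms
proof (induction N "minor q" rule: minor_of.induct)
  case refl
  then show ?case using ple_refl by blast
next
  case (deletion K H I)
  have q: "fst q \<in> carrier L" "snd q \<subseteq> carrier L" using deletion(4) by (auto simp: valid_def)
  obtain z A where p: "(K, H) = minor (z, A)" "ple L (z, A) q" using deletion by auto
  have v: "valid (z, A)" using ple_valid[OF p(2) q] .
  then have v': "valid (z, A - I)" by (auto simp: valid_def)
  have "K = L\<lparr>carrier := jspan L z A\<rparr>" "H = A" using p(1) minor_eq[OF v] by auto
  then have "deletion K H I = minor (z, A - I)" using deletion_M[OF v] by simp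
  moreover have "ple L (z, A - I) q"
    using ple_trans[OF _ p(2) q] ple_subset[OF v' v] by blast
  ultimately show ?case by blast
next
  case (contraction K H I)
  have q: "fst q \<in> carrier L" "snd q \<subseteq> carrier L" using contraction(4) by (auto simp: valid_def)
  obtain z A where p: "(K, H) = minor (z, A)" "ple L (z, A) q" using contraction by auto
  have v: "valid (z, A)" using ple_valid[OF p(2) q] .
  have KH: "K = L\<lparr>carrier := jspan L z A\<rparr>" "H = A" using p(1) minor_eq[OF v] by auto
  let ?i = "z \<squnion> \<Squnion>I" and ?B = "(\<lambda>g. g \<squnion> (z \<squnion> \<Squnion>I)) ` A - {z \<squnion> \<Squnion>I}"
  have "contraction K H I = minor (?i, ?B)"
    using contraction_M[OF v] KH contraction(3) by simp
  moreover have "?i \<in> jspan L z A"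
    using v contraction(3) KH(2) by (auto simp: jspan_eq valid_def)
  then have "ple L (?i, ?B) (z, A)" by (simp add: ple_def)
  ultimately show ?case using ple_trans[OF _ p(2) q] by blast
qed

text \<open>Write the minimum of \<open>p\<close> as \<open>z \<squnion> \<Squnion>X\<close>,
  contract by \<open>X\<close>, then delete the generators outside \<open>snd p\<close>.\<close>

lemma minor_ofI:
  assumes pq: "ple L p q" and v: "valid q"
  shows "minor_of (minor p) (minor q)"
proof -
  obtain z A where q: "q = (z, A)" by (cases q)
  have vq: "valid (z, A)" using v q by simp
  have q': "z \<in> carrier L" "A \<subseteq> carrier L" using vq by (auto simp: valid_def)
  have meq: "minor (z, A) = (L\<lparr>carrier := jspan L z A\<rparr>, A)" using minor_eq[OF vq] by simp
  define w where "w = fst p"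
  have "w \<in> jspan L z A" using pq q unfolding ple_def w_def by simp
  then obtain X where X: "X \<subseteq> A" "w = z \<squnion> \<Squnion>X"
    unfolding jspan_eq[OF q'] by blast
  let ?B = "(\<lambda>g. g \<squnion> w) ` A - {w}"
  have "minor_of (contraction (L\<lparr>carrier := jspan L z A\<rparr>) A X) (minor (z, A))"
    unfolding meq by (rule minor_of.contraction[OF minor_of.refl X(1)])
  then have 1: "minor_of (minor (w, ?B)) (minor (z, A))"
    using contraction_M[OF vq X(1)] X(2) by simp
  have "ple L (w, ?B) (z, A)" using \<open>w \<in> jspan L z A\<close> by (simp add: ple_def)
  then have vB: "valid (w, ?B)" using ple_valid q' by simp
  have beq: "minor (w, ?B) = (L\<lparr>carrier := jspan L w ?B\<rparr>, ?B)" using minor_eq[OF vB] by simp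
  have "minor_of (deletion (L\<lparr>carrier := jspan L w ?B\<rparr>) ?B (?B - snd p)) (minor (z, A))"
    using 1 unfolding beq by (rule minor_of.deletion) blast
  then have "minor_of (minor (w, ?B - (?B - snd p))) (minor (z, A))"
    using deletion_M[OF vB] by simp
  moreover have "?B - (?B - snd p) = snd p" using pq q unfolding ple_def w_def by auto
  ultimately show ?thesis using q by (simp add: w_def)
qed

text \<open>The record does not store the minimum, but it is recovered as the least element of the
  carrier.\<close>

lemma minor_inj:
  assumes "valid p" "valid q" "minor p = minor q"
  shows "p = q"
proof -
  have c: "fst p \<in> carrier L" "snd p \<subseteq> carrier L" "fst q \<in> carrier L" "snd q \<subseteq> carrier L"
    using assms by (auto simp: valid_def)
  have eq: "jspan L (fst p) (snd p) = jspan L (fst q) (snd q)" "snd p = snd q"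
    using assms(3) minor_eq[OF assms(1)] minor_eq[OF assms(2)]
    by (auto dest: arg_cong[of _ _ carrier])
  have "fst q \<sqsubseteq> fst p"
    using jspan_closed[OF c(3,4), of "fst p"] jspan.base[of "fst p" L "snd p"] eq by simp
  moreover have "fst p \<sqsubseteq> fst q"
    using jspan_closed[OF c(1,2), of "fst q"] jspan.base[of "fst q" L "snd q"] eq by simp
  ultimately show ?thesis using c eq le_antisym by (simp add: prod_eq_iff)
qed

lemma minor_of_iff:
  assumes p: "valid p" and q: "valid q"
  shows "minor_of (minor p) (minor q) \<longleftrightarrow> ple L p q"
proof
  assume "minor_of (minor p) (minor q)"
  then obtain p' where p': "minor p = minor p'" "ple L p' q" using minor_ofD q by blast
  then have "valid p'" using ple_valid q by (simp add: valid_def)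
  then show "ple L p q" using minor_inj[OF p _ p'(1)] p' by simp
qed (use minor_ofI q in blast)

end

section \<open>Transport from pairs to the minor poset\<close>

context gen_enriched_lattice
begin

lemma minor_top: "minor (\<bottom>, G) = (L, G)"
  using minor_eq[OF valid_top] by (simp add: jspan_bottom)

lemma carrier_minor_poset:
  "carrier (minor_poset L G) = map_option minor ` carrier (pair_poset L G)"
proof -
  have "{N. minor_of N (L, G)} = minor ` {p. ple L p (\<bottom>, G)}"
    (is "?l = ?r")
  proof (intro equalityI subsetI)
    fix N assume "N \<in> ?l"
    then show "N \<in> ?r" using minor_ofD[OF _ valid_top, of N] unfolding minor_top by blast
  next
    fix N assume "N \<in> ?r"
    then show "N \<in> ?l" using minor_ofI[OF _ valid_top] minor_top by auto
  qed
  then show ?thesis by (simp add: minor_poset_def pair_poset_def image_image)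
qed

lemma le_minor_poset:
  assumes "s \<in> carrier (pair_poset L G)" "t \<in> carrier (pair_poset L G)"
  shows "map_option minor s \<sqsubseteq>\<^bsub>minor_poset L G\<^esub> map_option minor t \<longleftrightarrow> s \<sqsubseteq>\<^bsub>pair_poset L G\<^esub> t"
  using assms by (cases s; cases t) (auto simp: minor_poset_def minor_of_iff pair_valid simp del: split_paired_All)

lemma inj_minor: "inj_on (map_option minor) (carrier (pair_poset L G))"
proof (rule inj_onI)
  fix s t assume "s \<in> carrier (pair_poset L G)" "t \<in> carrier (pair_poset L G)"
    "map_option minor s = map_option minor t"
  then show "s = t"
    by (cases s; cases t) (simp_all add: minor_inj pair_valid del: split_paired_All)
qed

text \<open>Antisymmetry is not visible in the inductive \<open>minor_of\<close>; it is inherited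
  from \<open>ple\<close>.\<close>

lemma partial_order_minor_poset: "partial_order (minor_poset L G)"
proof -
  interpret Q: partial_order "pair_poset L G" by (rule partial_order_pair_poset)
  have eqM: "eq (minor_poset L G) = (=)" by (simp add: minor_poset_def)
  show ?thesis
  proof unfold_locales
    fix x y z
    assume "x \<sqsubseteq>\<^bsub>minor_poset L G\<^esub> y" "y \<sqsubseteq>\<^bsub>minor_poset L G\<^esub> z"
      "x \<in> carrier (minor_poset L G)" "y \<in> carrier (minor_poset L G)" "z \<in> carrier (minor_poset L G)"
    then show "x \<sqsubseteq>\<^bsub>minor_poset L G\<^esub> z"
      unfolding carrier_minor_poset by (elim imageE) (simp add: le_minor_poset, rule Q.le_trans)
  next
    fix x y
    assume "x \<sqsubseteq>\<^bsub>minor_poset L G\<^esub> y" "y \<sqsubseteq>\<^bsub>minor_poset L G\<^esub> x"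
      "x \<in> carrier (minor_poset L G)" "y \<in> carrier (minor_poset L G)"
    then show "x .=\<^bsub>minor_poset L G\<^esub> y"
      unfolding carrier_minor_poset eqM
      by (elim imageE) (simp add: le_minor_poset, metis Q.le_antisym)
  next
    fix x assume "x \<in> carrier (minor_poset L G)"
    then show "x \<sqsubseteq>\<^bsub>minor_poset L G\<^esub> x"
      unfolding carrier_minor_poset by (elim imageE) (simp add: le_minor_poset)
  qed (simp_all add: eqM)
qed

lemma pair_poset_iso_minor_poset: "poset_isomorphic (pair_poset L G) (minor_poset L G)"
proof -
  interpret Q: partial_order "pair_poset L G" by (rule partial_order_pair_poset)
  interpret M: partial_order "minor_poset L G" by (rule partial_order_minor_poset)
  show ?thesis
    by (rule poset_isomorphicI[of "map_option minor"])
      (use inj_minor carrier_minor_poset le_minor_poset Q.weak_partial_order_axioms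
        M.weak_partial_order_axioms in \<open>auto simp: bij_betw_def\<close>)
qed

lemma carrier_minor_poset_not_UNIV: "carrier (minor_poset L G) \<noteq> UNIV"
proof
  assume "carrier (minor_poset L G) = UNIV"
  \<comment> \<open>A minor with generator \<open>\<bottom>\<close> would need a minimum strictly
    below \<open>\<bottom>\<close>.\<close>
  then have "Some (L, {\<bottom>}) \<in> map_option minor ` carrier (pair_poset L G)"
    using carrier_minor_poset by blast
  then obtain p where p: "ple L p (\<bottom>, G)" "minor p = (L, {\<bottom>})"
    by (auto simp: pair_poset_def simp del: split_paired_All)
  have v: "valid p" using pair_valid p by blast
  have "snd p = {\<bottom>}" using p(2) minor_eq[OF v] by simp
  then have "fst p \<sqsubset> \<bottom>" "fst p \<in> carrier L" using v by (auto simp: valid_def)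
  then show False using le_antisym[of "fst p" \<bottom>] by (simp add: lless_iff)
qed

end

theorem theorem5p2:
  fixes L :: "'a gorder" and G :: "'a set"
    and K :: "'b gorder" and H :: "'b set"
  assumes "gen_enriched_lattice L G"
    and "gen_enriched_lattice K H"
    and "\<exists>f. strong_surjection L G K H f"
  shows "\<exists>(r :: nat) P.
           P 0 = minor_poset L G \<and>
           (\<forall>i\<le>r. partial_order (P i)) \<and>
           (\<forall>i<r. zip_step (P i) (P (Suc i))) \<and>
           poset_isomorphic (P r) (minor_poset K H)"
proof -
  obtain f where f: "strong_surjection L G K H f" using assms(3) by blast
  have S: "strong_surj L G K H f"
    using assms(1,2) f by (intro strong_surj.intro strong_surj_axioms.intro)
  interpret L: gen_enriched_lattice L G by fact
  interpret K: gen_enriched_lattice K H by fact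
  let ?R = "\<lambda>P P'. partial_order P' \<and> zip_step P P'"
  have fin: "finite (carrier (minor_poset L G))"
    using L.carrier_minor_poset L.finite_pair_poset by simp
  obtain P' where P': "?R\<^sup>*\<^sup>* (minor_poset L G) P'" "poset_isomorphic P' (pair_poset K H)"
    using zip_along_strong_surjection[OF S L.partial_order_minor_poset fin
        L.carrier_minor_poset_not_UNIV poset_isomorphic_sym[OF L.pair_poset_iso_minor_poset]]
    by (elim exE conjE) (rule that)
  obtain r where "(?R ^^ r) (minor_poset L G) P'"
    using rtranclp_imp_relpowp[OF P'(1)] by (elim exE) (rule that)
  then obtain P where P: "P 0 = minor_poset L G" "P r = P'"
      "\<And>i. i < r \<Longrightarrow> partial_order (P (Suc i)) \<and> zip_step (P i) (P (Suc i))"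
    unfolding relpowp_fun_conv by blast
  \<comment> \<open>\<open>?R\<close> vouches only for the target of each step, so
    \<open>P 0\<close> is treated on its own.\<close>
  have "partial_order (P i)" if "i \<le> r" for i
    using that P L.partial_order_minor_poset by (cases i) auto
  moreover have "poset_isomorphic (P r) (minor_poset K H)"
    using P(2) P'(2) poset_isomorphic_trans K.pair_poset_iso_minor_poset by metis
  ultimately show ?thesis using P by blast
qed

end
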